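(* There is a universal constant $c>0$ such that for all integers $d\ge2$, all $0<\epsilon<1/6$ and all $\eta\ge0$ the following holds. Consider a copywise (incoherent) adaptive protocol using $N$ copies of $\rho\otimes\rho^*$ in which, for every POVM $\{M_o\}$ used in any round and every outcome $o$ with $\mathrm{Tr}\,M_o>0$, there is a density operator $\sigma_A^o$ on $A$ with $$\frac{M_o}{\mathrm{Tr}\,M_o}\ \le\ 2^\eta\, I_S\otimes\sigma_A^o .$$ If, for every $d$-dimensional state $\rho$, the protocol learns all displacement amplitudes of $\rho$ to additive error $\epsilon$ with success probability at least $2/3$, then $$N\ \ge\ c\,\epsilon^{-2}\sqrt{d\,2^{-\eta}} ,$$ i.e. $N=\Omega(\epsilon^{-2}\sqrt{d\,2^{-\eta}})$.
   Context: Displacement operators on $\mathbb C^d$ with computational basis $\{|j\rangle\}_{j\in\mathbb Z_d}$: $X|j\rangle=|j+1 \bmod d\rangle$, $Z|j\rangle=e^{2\pi ij/d}|j\rangle$, $D_{q,p}:=e^{i\pi qp/d}X^qZ^p$ for $q,p\in\mathbb Z_d$ (identified with representatives in $\{0,\dots,d-1\}$). The displacement amplitudes of a density operator $\rho$ on $\mathbb C^d$ are $y_{q,p}=\mathrm{Tr}(D_{q,p}\rho)$. $\rho^*$ is the entrywise complex conjugate of $\rho$ in the computational basis. $X\le Y$ for Hermitian operators means $Y-X$ is positive semidefinite. Learning task: given $N$ copies of $\rho\otimes\rho^*$ for an unknown $\rho$, output estimates $\hat y_{q,p}$ with $|\hat y_{q,p}-y_{q,p}|\le\epsilon$ simultaneously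 for all $q,p\in\mathbb Z_d$, with probability at least $2/3$. Copywise adaptive protocol: in round $m=1,\dots,N$ one copy of $\rho\otimes\rho^*$, held on registers $SA=S_mA_m$ ($S_m\cong\mathbb C^d$ contains $\rho$, $A_m\cong\mathbb C^d$ contains $\rho^*$), is measured separately by a joint POVM $\{M_{o_m}^{\mathbf o_{<m}}\}_{o_m}$ on $S_mA_m$ (finitely many outcomes), which may depend arbitrarily on the previous outcomes $\mathbf o_{<m}=(o_1,\dots,o_{m-1})$. No quantum memory is retained across copies. Estimates are computed from the full outcome record. *)

theory Defs
  imports Complex_Main "Jordan_Normal_Form.Schur_Decomposition"
begin

section \<open>Finite-dimensional operators\<close>

definition mat_trace :: "complex mat \<Rightarrow> complex" where
  "mat_trace A = (\<Sum>i<dim_row A. A $$ (i, i))"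

text \<open>In the last conjunct \<open>\<le>\<close> is the order on \<^typ>\<open>complex\<close>, so it says that the quadratic form
  is real and nonnegative.\<close>

definition psd :: "nat \<Rightarrow> complex mat \<Rightarrow> bool" where
  "psd n A \<longleftrightarrow> A \<in> carrier_mat n n \<and> mat_adjoint A = A \<and>
     (\<forall>v\<in>carrier_vec n. 0 \<le> (A *\<^sub>v v) \<bullet>c v)"

definition loewner_le :: "nat \<Rightarrow> complex mat \<Rightarrow> complex mat \<Rightarrow> bool" where
  "loewner_le n A B \<longleftrightarrow> psd n (B - A)"

definition density_op :: "nat \<Rightarrow> complex mat \<Rightarrow> bool" where
  "density_op n \<rho> \<longleftrightarrow> psd n \<rho> \<and> mat_trace \<rho> = 1"

text \<open>Kronecker product: the basis vector \<open>|s\<rangle> \<otimes> |a\<rangle>\<close> has index \<open>s * n + a\<close>, where \<open>n\<close> is the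
  dimension of the second factor.\<close>

definition kron :: "complex mat \<Rightarrow> complex mat \<Rightarrow> complex mat" where
  "kron A B = mat (dim_row A * dim_row B) (dim_col A * dim_col B)
     (\<lambda>(i, j). A $$ (i div dim_row B, j div dim_col B) * B $$ (i mod dim_row B, j mod dim_col B))"

definition with_conj :: "complex mat \<Rightarrow> complex mat" where
  "with_conj \<rho> = kron \<rho> (map_mat cnj \<rho>)"


section \<open>Displacement operators\<close>

definition shift_X :: "nat \<Rightarrow> complex mat" where
  "shift_X d = mat d d (\<lambda>(i, j). if i = (j + 1) mod d then 1 else 0)"

definition clock_Z :: "nat \<Rightarrow> complex mat" where
  "clock_Z d = mat d d (\<lambda>(i, j). if i = j then cis (2 * pi * real j / real d) else 0)"

definition displacement :: "nat \<Rightarrow> nat \<Rightarrow> nat \<Rightarrow> complex mat" where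
  "displacement d q p =
     cis (pi * real q * real p / real d) \<cdot>\<^sub>m ((shift_X d ^\<^sub>m q) * (clock_Z d ^\<^sub>m p))"

definition amplitude :: "nat \<Rightarrow> complex mat \<Rightarrow> nat \<Rightarrow> nat \<Rightarrow> complex" where
  "amplitude d \<rho> q p = mat_trace (displacement d q p * \<rho>)"


section \<open>Measurements and copywise adaptive protocols\<close>

definition povm :: "nat \<Rightarrow> nat set \<Rightarrow> (nat \<Rightarrow> complex mat) \<Rightarrow> bool" where
  "povm n K M \<longleftrightarrow> finite K \<and> (\<forall>k\<in>K. psd n (M k)) \<and>
     mat n n (\<lambda>ij. \<Sum>k\<in>K. M k $$ ij) = 1\<^sub>m n"

definition povm_bounded :: "nat \<Rightarrow> real \<Rightarrow> nat set \<Rightarrow> (nat \<Rightarrow> complex mat) \<Rightarrow> bool" where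
  "povm_bounded d \<eta> K M \<longleftrightarrow>
     (\<forall>k\<in>K. 0 < mat_trace (M k) \<longrightarrow>
        (\<exists>\<sigma>. density_op d \<sigma> \<and>
           loewner_le (d * d) ((1 / mat_trace (M k)) \<cdot>\<^sub>m M k)
             (complex_of_real (2 powr \<eta>) \<cdot>\<^sub>m kron (1\<^sub>m d) \<sigma>)))"

text \<open>The list argument is the record of all previous outcomes in chronological order; its length
  determines the round. Outcomes are labelled by natural numbers, and the set of labels may itself
  depend on the history.\<close>

record protocol =
  outcomes :: "nat list \<Rightarrow> nat set"
  effect :: "nat list \<Rightarrow> nat \<Rightarrow> complex mat"
  estimate :: "nat list \<Rightarrow> nat \<Rightarrow> nat \<Rightarrow> complex"

definition records :: "protocol \<Rightarrow> nat \<Rightarrow> nat list set" where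
  "records P m = {os. length os = m \<and> (\<forall>i<m. os ! i \<in> outcomes P (take i os))}"

definition copywise_protocol :: "nat \<Rightarrow> nat \<Rightarrow> protocol \<Rightarrow> bool" where
  "copywise_protocol d N P \<longleftrightarrow>
     (\<forall>m<N. \<forall>h\<in>records P m. povm (d * d) (outcomes P h) (effect P h))"

definition protocol_bounded :: "nat \<Rightarrow> nat \<Rightarrow> real \<Rightarrow> protocol \<Rightarrow> bool" where
  "protocol_bounded d N \<eta> P \<longleftrightarrow>
     (\<forall>m<N. \<forall>h\<in>records P m. povm_bounded d \<eta> (outcomes P h) (effect P h))"

text \<open>Born rule: each round measures a fresh copy of \<open>\<rho> \<otimes> \<rho>\<^sup>*\<close>. The traces are real, so taking
  the real part only changes the type.\<close>

definition record_prob :: "protocol \<Rightarrow> complex mat \<Rightarrow> nat list \<Rightarrow> real" where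
  "record_prob P \<rho> os =
     (\<Prod>i<length os. Re (mat_trace (effect P (take i os) (os ! i) * with_conj \<rho>)))"

definition success_prob :: "nat \<Rightarrow> nat \<Rightarrow> real \<Rightarrow> protocol \<Rightarrow> complex mat \<Rightarrow> real" where
  "success_prob d N \<epsilon> P \<rho> =
     (\<Sum>os\<in>{os \<in> records P N. \<forall>q<d. \<forall>p<d. cmod (estimate P os q p - amplitude d \<rho> q p) \<le> \<epsilon>}.
        record_prob P \<rho> os)"

definition learns_amplitudes :: "nat \<Rightarrow> nat \<Rightarrow> real \<Rightarrow> protocol \<Rightarrow> bool" where
  "learns_amplitudes d N \<epsilon> P \<longleftrightarrow> (\<forall>\<rho>. density_op d \<rho> \<longrightarrow> success_prob d N \<epsilon> P \<rho> \<ge> 2 / 3)"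

end

theory Submission
  imports Defs
begin

text \<open>For \<open>(q, p) \<noteq> (0, 0)\<close> and a phase \<open>z\<close> let \<open>H\<close> be the Hermitian part of \<open>z D\<close>, \<open>D\<close> being the displacement
  operator of \<open>(q, p)\<close>, and compare the state \<open>(I + t H) / d\<close>, \<open>t = 11 \<epsilon> / 5\<close>, with the maximally mixed
  state. For a suitable \<open>z\<close> a successful protocol distinguishes the two, so the Kullback-Leibler divergence
  between their outcome records is bounded below by a constant, for every \<open>(q, p)\<close>. By the chain rule
  the sum of these divergences over \<open>(q, p)\<close> is at most \<open>N\<close> times the largest contribution of a single
  measurement, however adaptive the protocol is.

  For an effect \<open>M\<close> of trace one the likelihood ratio is \<open>1 + t u + t v + t\<^sup>2 w\<close>, where \<open>u\<close> and \<open>v\<close> are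
  the expectations of \<open>H\<close> and its conjugate in the two marginals of \<open>M\<close>, and \<open>w\<close> is that of their tensor
  product. Parseval's identity gives \<open>\<Sum> u\<^sup>2 \<le> d\<close> and \<open>\<Sum> v\<^sup>2 \<le> d\<close>. The operators \<open>D \<otimes> D\<^sup>*\<close> (star
  denoting the entrywise conjugate) have a common eigenbasis of maximally entangled vectors, so again
  by Parseval \<open>\<Sum> w\<^sup>2\<close> is at most \<open>d\<^sup>2\<close> times the largest weight of \<open>M\<close> on such a vector; the hypothesis
  \<open>M \<le> 2\<^sup>\<eta> I \<otimes> \<sigma>\<close> bounds this weight by \<open>2\<^sup>\<eta> / d\<close>.\<close>

section \<open>Positive kernels on finite sets\<close>

text \<open>Constraining the real part suffices, since the form of a Hermitian kernel is real.\<close>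

definition hpos :: "'i set \<Rightarrow> ('i \<Rightarrow> 'i \<Rightarrow> complex) \<Rightarrow> bool" where
  "hpos I A \<longleftrightarrow> (\<forall>i\<in>I. \<forall>j\<in>I. A j i = cnj (A i j)) \<and>
     (\<forall>v. 0 \<le> Re (\<Sum>i\<in>I. \<Sum>j\<in>I. cnj (v i) * A i j * v j))"

lemma hpos_herm: "hpos I A \<Longrightarrow> i \<in> I \<Longrightarrow> j \<in> I \<Longrightarrow> A j i = cnj (A i j)"
  unfolding hpos_def by blast

lemma hpos_form: "hpos I A \<Longrightarrow> 0 \<le> Re (\<Sum>i\<in>I. \<Sum>j\<in>I. cnj (v i) * A i j * v j)"
  unfolding hpos_def by blast

lemma hpos_diag_real: assumes "hpos I A" "i \<in> I" shows "Im (A i i) = 0"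
proof -
  have "Im (A i i) = Im (cnj (A i i))" by (rule arg_cong[OF hpos_herm[OF assms(1,2,2)]])
  then show ?thesis by simp
qed

text \<open>A test vector on \<open>J\<close> is carried along \<open>g\<close> and extended by
  zero. This one rule yields principal submatrices, relabelled kernels and the blocks of a bipartite
  kernel.\<close>

lemma hpos_compress:
  assumes "hpos I A" and fin: "finite I" and J: "finite J" and inj: "inj_on g J" and sub: "g ` J \<subseteq> I"
  shows "hpos J (\<lambda>j k. A (g j) (g k))"
  unfolding hpos_def
proof (intro conjI ballI allI)
  fix i j assume "i \<in> J" "j \<in> J"
  then show "A (g j) (g i) = cnj (A (g i) (g j))"
    using hpos_herm[OF assms(1)] sub by blast
next
  fix v :: "_ \<Rightarrow> complex"
  define w where "w i = (if i \<in> g ` J then v (the_inv_into J g i) else 0)" for i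
  have wg: "w (g j) = v j" if "j \<in> J" for j
    using that inj by (auto simp: w_def the_inv_into_f_f)
  have red: "(\<Sum>j\<in>I. f j * w j) = (\<Sum>j\<in>J. f (g j) * v j)" for f
  proof -
    have "(\<Sum>j\<in>I. f j * w j) = (\<Sum>j\<in>g ` J. f j * w j)"
      using sub fin by (intro sum.mono_neutral_right) (auto simp: w_def)
    also have "\<dots> = (\<Sum>j\<in>J. f (g j) * v j)"
      by (simp add: sum.reindex[OF inj] wg)
    finally show ?thesis .
  qed
  have redc: "(\<Sum>j\<in>I. cnj (w j) * f j) = (\<Sum>j\<in>J. cnj (v j) * f (g j))" for f
    using arg_cong[OF red[of "\<lambda>j. cnj (f j)"], of cnj] by (simp add: mult.commute)
  have "(\<Sum>i\<in>I. \<Sum>j\<in>I. cnj (w i) * A i j * w j) = (\<Sum>i\<in>J. \<Sum>j\<in>J. cnj (v i) * A (g i) (g j) * v j)"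
    by (simp add: red redc mult.assoc flip: sum_distrib_left)
  with hpos_form[OF assms(1), of w]
  show "0 \<le> Re (\<Sum>i\<in>J. \<Sum>j\<in>J. cnj (v i) * A (g i) (g j) * v j)" by simp
qed

lemma hpos_sum:
  assumes "\<And>a. a \<in> S \<Longrightarrow> hpos I (A a)"
  shows "hpos I (\<lambda>i j. \<Sum>a\<in>S. A a i j)"
  unfolding hpos_def
proof (intro conjI ballI allI)
  fix i j assume "i \<in> I" "j \<in> I"
  then show "(\<Sum>a\<in>S. A a j i) = cnj (\<Sum>a\<in>S. A a i j)"
    unfolding cnj_sum by (intro sum.cong refl hpos_herm[OF assms])
next
  fix v :: "_ \<Rightarrow> complex"
  have "(\<Sum>i\<in>I. \<Sum>j\<in>I. cnj (v i) * (\<Sum>a\<in>S. A a i j) * v j) =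
        (\<Sum>i\<in>I. \<Sum>j\<in>I. \<Sum>a\<in>S. cnj (v i) * A a i j * v j)"
    by (simp add: sum_distrib_left sum_distrib_right)
  also have "\<dots> = (\<Sum>a\<in>S. \<Sum>i\<in>I. \<Sum>j\<in>I. cnj (v i) * A a i j * v j)"
    by (simp only: sum.swap[of _ S])
  finally have eq: "Re (\<Sum>i\<in>I. \<Sum>j\<in>I. cnj (v i) * (\<Sum>a\<in>S. A a i j) * v j) =
      (\<Sum>a\<in>S. Re (\<Sum>i\<in>I. \<Sum>j\<in>I. cnj (v i) * A a i j * v j))"
    by (simp only: Re_sum)
  show "0 \<le> Re (\<Sum>i\<in>I. \<Sum>j\<in>I. cnj (v i) * (\<Sum>a\<in>S. A a i j) * v j)"
    unfolding eq by (intro sum_nonneg hpos_form assms)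
qed

lemma hpos_transpose:
  assumes "hpos I A" shows "hpos I (\<lambda>i j. A j i)"
  unfolding hpos_def
proof (intro conjI ballI allI)
  fix v :: "_ \<Rightarrow> complex"
  have "(\<Sum>i\<in>I. \<Sum>j\<in>I. cnj (v i) * A j i * v j) = (\<Sum>j\<in>I. \<Sum>i\<in>I. cnj (cnj (v j)) * A j i * cnj (v i))"
    by (subst sum.swap) (simp only: mult_ac complex_cnj_cnj)
  then show "0 \<le> Re (\<Sum>i\<in>I. \<Sum>j\<in>I. cnj (v i) * A j i * v j)"
    using hpos_form[OF assms, of "\<lambda>i. cnj (v i)"] by simp
qed (rule hpos_herm[OF assms])

lemma hpos_diag_nonneg:
  assumes "hpos I A" "finite I" "i \<in> I" shows "0 \<le> Re (A i i)"
proof -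
  have "hpos {()} (\<lambda>_ _. A i i)"
    using hpos_compress[OF assms(1,2), of "{()}" "\<lambda>_. i"] assms(3) by simp
  from hpos_form[OF this, of "\<lambda>_. 1"] show ?thesis by simp
qed

text \<open>The form on the two indices, evaluated at \<open>(- l * A i j, 1)\<close>, is the real
  polynomial in \<open>l\<close> of \<open>key\<close>; the claim says that it stays nonnegative for
  every \<open>l\<close>.\<close>

lemma hpos_minor:
  assumes "hpos I A" "finite I" "i \<in> I" "j \<in> I"
  shows "(cmod (A i j))\<^sup>2 \<le> Re (A i i) * Re (A j j)"
proof (cases "i = j")
  case True
  then show ?thesis using hpos_diag_real[OF assms(1,3)] unfolding cmod_power2 by (simp add: power2_eq_square)
next
  case False
  have "hpos {False, True} (\<lambda>b c. A (if b then j else i) (if c then j else i))"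
    using hpos_compress[OF assms(1,2), of "{False, True}" "\<lambda>b. if b then j else i"] assms(3,4) False
    by (simp add: inj_on_def)
  then have form:
    "0 \<le> Re (cnj x * A i i * x + cnj x * A i j * y + (cnj y * A j i * x + cnj y * A j j * y))" for x y
    using hpos_form[of "{False, True}" _ "\<lambda>b. if b then y else x"] by fastforce
  define c where "c = (cmod (A i j))\<^sup>2"
  have c: "c = (Re (A i j))\<^sup>2 + (Im (A i j))\<^sup>2" unfolding c_def by (rule cmod_power2)
  have key: "0 \<le> l\<^sup>2 * c * Re (A i i) + Re (A j j) - 2 * l * c" for l :: real
    using form[of "- of_real l * A i j" 1] hpos_diag_real[OF assms(1,3)] hpos_herm[OF assms(1,3,4)]
    by (simp add: c algebra_simps power2_eq_square)
  have nn: "0 \<le> Re (A i i)" "0 \<le> Re (A j j)" "0 \<le> c"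
    using hpos_diag_nonneg[OF assms(1,2,3)] hpos_diag_nonneg[OF assms(1,2,4)] by (simp_all add: c_def)
  show ?thesis
  proof (cases "Re (A i i) = 0")
    case True
    have "c = 0"
    proof (rule ccontr)
      assume "c \<noteq> 0"
      \<comment> \<open>With a vanishing diagonal entry the polynomial is affine in \<open>l\<close>
        with slope \<open>- 2 * c\<close>, and this \<open>l\<close> makes it negative.\<close>
      then show False using key[of "(Re (A j j) + 1) / c"] True nn by simp
    qed
    then show ?thesis using nn by (simp add: c_def)
  next
    case ne: False
    \<comment> \<open>The minimum of the quadratic lies at
      \<open>l = 1 / Re (A i i)\<close>.\<close>
    have "0 \<le> Re (A j j) - c / Re (A i i)"
      using key[of "1 / Re (A i i)"] ne by (simp add: power2_eq_square)
    then show ?thesis using ne nn unfolding c_def by (simp add: field_simps)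
  qed
qed

lemma hpos_norm_le:
  assumes "hpos I A" "finite I" "i \<in> I" "j \<in> I"
  shows "cmod (A i j) \<le> (Re (A i i) + Re (A j j)) / 2"
proof (rule power2_le_imp_le)
  have "(cmod (A i j))\<^sup>2 \<le> Re (A i i) * Re (A j j)" by (rule hpos_minor[OF assms])
  also have "\<dots> \<le> ((Re (A i i) + Re (A j j)) / 2)\<^sup>2"
    using zero_le_power2[of "Re (A i i) - Re (A j j)"] by (simp add: power2_eq_square field_simps)
  finally show "(cmod (A i j))\<^sup>2 \<le> ((Re (A i i) + Re (A j j)) / 2)\<^sup>2" .
next
  show "0 \<le> (Re (A i i) + Re (A j j)) / 2"
    using hpos_diag_nonneg[OF assms(1,2,3)] hpos_diag_nonneg[OF assms(1,2,4)] by simp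
qed

text \<open>A permutation meets every diagonal entry once, so the arithmetic means from
  \<open>hpos_norm_le\<close> add up to the trace. Multiplied by phases, the entries on the left
  form the trace of \<open>A\<close> against a monomial unitary; this is how expectations of
  displacement operators are bounded.\<close>

lemma hpos_perm_sum_le:
  assumes "hpos I A" "finite I" "bij_betw f I I"
  shows "(\<Sum>i\<in>I. cmod (A i (f i))) \<le> (\<Sum>i\<in>I. Re (A i i))"
proof -
  have "(\<Sum>i\<in>I. cmod (A i (f i))) \<le> (\<Sum>i\<in>I. (Re (A i i) + Re (A (f i) (f i))) / 2)"
    using assms bij_betwE[OF assms(3)] by (intro sum_mono hpos_norm_le) auto
  also have "\<dots> = ((\<Sum>i\<in>I. Re (A i i)) + (\<Sum>i\<in>I. Re (A (f i) (f i)))) / 2"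
    by (simp add: sum.distrib flip: sum_divide_distrib)
  also have "(\<Sum>i\<in>I. Re (A (f i) (f i))) = (\<Sum>i\<in>I. Re (A i i))"
    by (rule sum.reindex_bij_betw[OF assms(3)])
  finally show ?thesis by simp
qed

text \<open>The left side is the trace of \<open>A^2\<close>; the bounds on the minors are summed
  over all pairs of indices.\<close>

lemma hpos_frobenius_le:
  assumes "hpos I A" "finite I"
  shows "(\<Sum>i\<in>I. \<Sum>j\<in>I. (cmod (A i j))\<^sup>2) \<le> (\<Sum>i\<in>I. Re (A i i))\<^sup>2"
proof -
  have "(\<Sum>i\<in>I. \<Sum>j\<in>I. (cmod (A i j))\<^sup>2) \<le> (\<Sum>i\<in>I. \<Sum>j\<in>I. Re (A i i) * Re (A j j))"
    by (intro sum_mono hpos_minor[OF assms])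
  then show ?thesis by (simp add: power2_eq_square sum_product)
qed

section \<open>Fourier analysis on the cyclic group\<close>

text \<open>The characters of the cyclic group are \<open>wroot d (p * k)\<close>. The exponent is
  any natural number; inverses are written as conjugates or with exponent
  \<open>d - k\<close>.\<close>

definition wroot :: "nat \<Rightarrow> nat \<Rightarrow> complex" where
  "wroot d k = cis (2 * pi * real k / real d)"

lemma wroot_0 [simp]: "wroot d 0 = 1" by (simp add: wroot_def)

lemma wroot_add: "wroot d (k + l) = wroot d k * wroot d l"
  by (simp add: wroot_def cis_mult distrib_left add_divide_distrib)

lemma wroot_norm [simp]: "cmod (wroot d k) = 1" by (simp add: wroot_def)

lemma wroot_cnj: "cnj (wroot d k) * wroot d k = 1" "wroot d k * cnj (wroot d k) = 1"
  by (simp_all add: wroot_def cis_cnj cis_mult)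

lemma wroot_mult_period: assumes "d > 0" shows "wroot d (d * k) = 1"
proof -
  have "2 * pi * real (d * k) / real d = 2 * pi * real k" using assms by simp
  then show ?thesis by (simp add: wroot_def)
qed

lemma wroot_mod: assumes "d > 0" shows "wroot d (p * (k mod d)) = wroot d (p * k)"
proof -
  have "wroot d (p * k) = wroot d (p * (k mod d) + d * (p * (k div d)))"
  proof (rule arg_cong[where f = "wroot d"])
    have "p * k = p * (k mod d + d * (k div d))" by simp
    then show "p * k = p * (k mod d) + d * (p * (k div d))" by (simp only: distrib_left mult.left_commute)
  qed
  then show ?thesis using wroot_mult_period[OF assms] by (simp add: wroot_add)
qed

lemma wroot_pow: "wroot d (p * k) = wroot d k ^ p"
  by (induction p) (simp_all add: wroot_add)

lemma wroot_eq_1D: assumes "d > 0" "wroot d k = 1" shows "d dvd k"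
proof -
  have "cos (2 * pi * real k / real d) = 1"
    using assms(2) by (simp add: wroot_def complex_eq_iff)
  then obtain n :: int where "2 * pi * real k / real d = of_int n * 2 * pi"
    using cos_one_2pi_int by blast
  then have "real k = of_int n * real d" using assms(1) by (simp add: field_simps)
  then have "real_of_int (int k) = real_of_int (n * int d)" by simp
  then have "int k = n * int d" by (simp only: of_int_eq_iff)
  then have "int d dvd int k" by simp
  then show ?thesis by simp
qed

lemma wroot_sum:
  assumes "d > 0"
  shows "(\<Sum>p<d. wroot d (p * k)) = (if d dvd k then of_nat d else 0)"
proof (cases "d dvd k")
  case True
  then obtain m where "k = d * m" ..
  then have "wroot d (p * k) = 1" for p
    using wroot_mult_period[OF assms, of "p * m"] by (simp add: mult.left_commute)
  then show ?thesis using True by simp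
next
  case False
  then have ne: "wroot d k \<noteq> 1" using wroot_eq_1D[OF assms] by blast
  have "(\<Sum>p<d. wroot d (p * k)) = (wroot d k ^ d - 1) / (wroot d k - 1)"
    by (simp add: wroot_pow geometric_sum[OF ne])
  also have "wroot d k ^ d = 1" using wroot_mult_period[OF assms, of k] by (simp add: wroot_pow)
  finally show ?thesis using False by simp
qed

lemma wroot_orthogonal:
  assumes "r < d" "r' < d"
  shows "(\<Sum>p<d. wroot d (p * r) * cnj (wroot d (p * r'))) = (if r = r' then of_nat d else 0)"
proof -
  have d: "d > 0" using assms by simp
  \<comment> \<open>The conjugate is rewritten with a natural exponent, so that the product of the
    two characters becomes a single character sum.\<close>
  have inv: "cnj (wroot d (p * r')) = wroot d (p * (d - r'))" for p
  proof -
    have "wroot d (p * (d - r')) * wroot d (p * r') = wroot d (p * (d - r') + p * r')"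
      by (simp add: wroot_add)
    also have "p * (d - r') + p * r' = d * p"
      using assms by (simp add: algebra_simps)
    finally have 1: "wroot d (p * (d - r')) * wroot d (p * r') = 1"
      using wroot_mult_period[OF d] by simp
    have "wroot d (p * (d - r')) = wroot d (p * (d - r')) * (wroot d (p * r') * cnj (wroot d (p * r')))"
      by (simp add: wroot_cnj)
    also have "\<dots> = cnj (wroot d (p * r'))" using 1 by (simp flip: mult.assoc)
    finally show ?thesis by simp
  qed
  have "d dvd r + (d - r') \<longleftrightarrow> r = r'"
  proof
    assume "d dvd r + (d - r')"
    then obtain m where m: "r + (d - r') = d * m" ..
    \<comment> \<open>The number \<open>r + (d - r')\<close> lies strictly between \<open>0\<close>
      and \<open>2 * d\<close>, so the only multiple of \<open>d\<close> it can be is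
      \<open>d\<close> itself.\<close>
    have "0 < d * m" "d * m < d * 2" using assms m by linarith+
    then have "m = 1" by simp
    then show "r = r'" using m assms by simp
  qed (use assms in simp)
  then show ?thesis
    using wroot_sum[OF d, of "r + (d - r')"]
    by (simp add: inv distrib_left wroot_add)
qed

lemma parseval:
  "(\<Sum>p<d. (cmod (\<Sum>r<d. wroot d (p * r) * f r))\<^sup>2) = real d * (\<Sum>r<d. (cmod (f r))\<^sup>2)"
proof -
  have "complex_of_real (\<Sum>p<d. (cmod (\<Sum>r<d. wroot d (p * r) * f r))\<^sup>2)
      = (\<Sum>p<d. \<Sum>r<d. \<Sum>r'<d. (f r * cnj (f r')) * (wroot d (p * r) * cnj (wroot d (p * r'))))"
    by (simp only: of_real_sum complex_norm_square cnj_sum complex_cnj_mult sum_product mult_ac)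
  also have "\<dots> = (\<Sum>r<d. \<Sum>p<d. \<Sum>r'<d. (f r * cnj (f r')) * (wroot d (p * r) * cnj (wroot d (p * r'))))"
    by (rule sum.swap)
  also have "\<dots> = (\<Sum>r<d. \<Sum>r'<d. \<Sum>p<d. (f r * cnj (f r')) * (wroot d (p * r) * cnj (wroot d (p * r'))))"
    by (intro sum.cong refl sum.swap)
  also have "\<dots> = (\<Sum>r<d. \<Sum>r'<d. (f r * cnj (f r')) * (if r = r' then of_nat d else 0))"
    by (intro sum.cong refl) (simp add: wroot_orthogonal flip: sum_distrib_left)
  also have "\<dots> = (\<Sum>r<d. of_nat d * (f r * cnj (f r)))"
    by (intro sum.cong refl) (simp add: if_distrib cong: if_cong)
  also have "\<dots> = complex_of_real (real d * (\<Sum>r<d. (cmod (f r))\<^sup>2))"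
    by (simp only: of_real_mult of_real_sum of_real_of_nat_eq complex_norm_square sum_distrib_left)
  finally show ?thesis by (simp only: of_real_eq_iff)
qed

section \<open>Shifts and negation of residues modulo d\<close>

lemma bij_shift: "bij_betw (\<lambda>k. (q + k) mod d) {..<d} {..<d :: nat}"
proof (cases "d = 0")
  case False
  have eq: "x = y" if "x \<le> y" "y < d" "(q + x) mod d = (q + y) mod d" for x y
  proof -
    have "d dvd (q + y) - (q + x)" using that mod_eq_dvd_iff_nat[of "q + x" "q + y" d] by simp
    then have "d dvd y - x" by simp
    then show ?thesis using that(1,2) by (cases "y - x = 0") (auto dest: dvd_imp_le)
  qed
  have "inj_on (\<lambda>k. (q + k) mod d) {..<d}"
  proof (rule inj_onI)
    fix x y assume "x \<in> {..<d}" "y \<in> {..<d}" "(q + x) mod d = (q + y) mod d"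
    then show "x = y" using eq[of x y] eq[of y x] by (cases "x \<le> y") auto
  qed
  moreover have "(\<lambda>k. (q + k) mod d) ` {..<d} \<subseteq> {..<d}" using False by auto
  ultimately show ?thesis by (simp add: bij_betw_def endo_inj_surj)
qed (simp add: bij_betw_def)

lemma sum_shift: "(\<Sum>k<d. f ((q + k) mod d)) = (\<Sum>k<d. f k)" for d :: nat
  by (rule sum.reindex_bij_betw[OF bij_shift])

lemma sum_shift': "(\<Sum>k<d. f ((k + q) mod d)) = (\<Sum>k<d. f k)" for d :: nat
  using sum_shift[of f q d] by (simp add: add.commute)

lemma bij_neg: "bij_betw (\<lambda>k. (d - k) mod d) {..<d} {..<d :: nat}"
proof (cases "d = 0")
  case False
  have "inj_on (\<lambda>k. (d - k) mod d) {..<d}"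
  proof (rule inj_onI)
    fix x y assume xy: "x \<in> {..<d}" "y \<in> {..<d}" "(d - x) mod d = (d - y) mod d"
    have "(d - z) mod d = (if z = 0 then 0 else d - z)" if "z < d" for z
      using that by auto
    then show "x = y" using xy by (auto split: if_splits)
  qed
  moreover have "(\<lambda>k. (d - k) mod d) ` {..<d} \<subseteq> {..<d}" using False by auto
  ultimately show ?thesis by (simp add: bij_betw_def endo_inj_surj)
qed (simp add: bij_betw_def)

section \<open>Parseval bounds for sums along displaced diagonals\<close>

lemma hpos_form_real:
  assumes "hpos I A"
  shows "Im (\<Sum>i\<in>I. \<Sum>j\<in>I. cnj (v i) * A i j * v j) = 0"
proof -
  have "cnj (\<Sum>i\<in>I. \<Sum>j\<in>I. cnj (v i) * A i j * v j) = (\<Sum>i\<in>I. \<Sum>j\<in>I. cnj (v j) * cnj (A i j) * v i)"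
    by (simp add: mult_ac)
  also have "\<dots> = (\<Sum>i\<in>I. \<Sum>j\<in>I. cnj (v j) * A j i * v i)"
    by (intro sum.cong refl) (simp only: hpos_herm[OF assms, symmetric])
  also have "\<dots> = (\<Sum>i\<in>I. \<Sum>j\<in>I. cnj (v i) * A i j * v j)"
    by (rule sum.swap)
  finally have "Im (cnj (\<Sum>i\<in>I. \<Sum>j\<in>I. cnj (v i) * A i j * v j)) = Im (\<Sum>i\<in>I. \<Sum>j\<in>I. cnj (v i) * A i j * v j)"
    by (rule arg_cong)
  then show ?thesis by (simp only: cnj.simps)
qed

text \<open>The hypothesis bounds the diagonal of \<open>A\<close> in the Fourier basis; the sums on the left are the
  Fourier transform of that diagonal.\<close>

lemma circulant_sums_le:
  assumes A: "hpos {..<d} A"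
    and bound: "\<And>s. Re (\<Sum>k<d. \<Sum>l<d. cnj (wroot d (s * k)) * A k l * wroot d (s * l)) \<le> \<beta>"
  shows "(\<Sum>q<d. (cmod (\<Sum>k<d. A k ((k + q) mod d)))\<^sup>2) \<le> \<beta> * (\<Sum>k<d. Re (A k k))"
proof (cases "d = 0")
  case False
  then have d: "d > 0" by simp
  define G where "G q = (\<Sum>k<d. A k ((k + q) mod d))" for q
  define F where "F s = (\<Sum>k<d. \<Sum>l<d. cnj (wroot d (s * k)) * A k l * wroot d (s * l))" for s
  have F_G: "F s = (\<Sum>q<d. wroot d (s * q) * G q)" for s
  proof -
    have "F s = (\<Sum>k<d. \<Sum>q<d. cnj (wroot d (s * k)) * A k ((k + q) mod d) * wroot d (s * ((k + q) mod d)))"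
      unfolding F_def by (intro sum.cong refl sum_shift[symmetric])
    also have "\<dots> = (\<Sum>k<d. \<Sum>q<d. wroot d (s * q) * A k ((k + q) mod d))"
    proof (intro sum.cong refl)
      fix k q
      have "cnj (wroot d (s * k)) * A k ((k + q) mod d) * wroot d (s * ((k + q) mod d)) =
        (cnj (wroot d (s * k)) * wroot d (s * k)) * (wroot d (s * q) * A k ((k + q) mod d))"
        by (simp add: wroot_mod[OF d] distrib_left wroot_add mult_ac)
      then show "cnj (wroot d (s * k)) * A k ((k + q) mod d) * wroot d (s * ((k + q) mod d)) =
          wroot d (s * q) * A k ((k + q) mod d)"
        by (simp add: wroot_cnj)
    qed
    also have "\<dots> = (\<Sum>q<d. wroot d (s * q) * G q)"
      unfolding G_def by (subst sum.swap) (simp add: sum_distrib_left)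
    finally show ?thesis .
  qed
  have F0: "0 \<le> Re (F s)" "cmod (F s) = Re (F s)" for s
  proof -
    show *: "0 \<le> Re (F s)"
      using hpos_form[OF A, of "\<lambda>k. wroot d (s * k)"] by (simp add: F_def)
    have "Im (F s) = 0"
      using hpos_form_real[OF A, of "\<lambda>k. wroot d (s * k)"] by (simp only: F_def)
    then show "cmod (F s) = Re (F s)" using * by (simp add: cmod_eq_Re)
  qed
  \<comment> \<open>Summing over all frequencies keeps only the undisplaced diagonal
    \<open>G 0\<close>, which is the trace.\<close>
  have "(\<Sum>s<d. F s) = (\<Sum>q<d. G q * (\<Sum>s<d. wroot d (s * q)))"
    unfolding F_G by (subst sum.swap) (simp add: sum_distrib_left mult.commute)
  also have "\<dots> = (\<Sum>q<d. if q = 0 then of_nat d * G 0 else 0)"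
    by (intro sum.cong refl) (auto simp: wroot_sum[OF d] dest: nat_dvd_not_less)
  also have "\<dots> = of_nat d * G 0" using d by simp
  finally have sumF: "(\<Sum>s<d. F s) = of_nat d * G 0" .
  have G0: "Re (G 0) = (\<Sum>k<d. Re (A k k))" unfolding G_def by simp
  have "real d * (\<Sum>q<d. (cmod (G q))\<^sup>2) = (\<Sum>s<d. (cmod (F s))\<^sup>2)"
    unfolding F_G by (rule parseval[symmetric])
  \<comment> \<open>Only one of the two factors of the square is bounded by \<beta>; the other is
    kept, because its sum is \<open>d\<close> times the trace.\<close>
  also have "\<dots> \<le> (\<Sum>s<d. \<beta> * Re (F s))"
  proof (intro sum_mono)
    fix s
    have "Re (F s) * Re (F s) \<le> \<beta> * Re (F s)"
      using bound[of s] F0(1)[of s] by (intro mult_right_mono) (simp_all only: F_def)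
    then show "(cmod (F s))\<^sup>2 \<le> \<beta> * Re (F s)" by (simp add: F0(2) power2_eq_square)
  qed
  also have "\<dots> = \<beta> * Re (\<Sum>s<d. F s)" by (simp add: sum_distrib_left)
  also have "\<dots> = real d * (\<beta> * (\<Sum>k<d. Re (A k k)))" unfolding sumF by (simp add: G0)
  finally show ?thesis using d unfolding G_def by simp
qed simp

text \<open>The hypothesis bounds the unnormalised weight of \<open>M\<close> on the maximally entangled vector supported
  on the pairs with difference \<open>r\<close> and having Fourier phase \<open>s\<close>.\<close>

lemma bell_sums_le:
  assumes M: "hpos ({..<d} \<times> {..<d}) M"
    and bound: "\<And>r s. Re (\<Sum>k<d. \<Sum>l<d. cnj (wroot d (s * k)) *
      M ((r + k) mod d, k) ((r + l) mod d, l) * wroot d (s * l)) \<le> \<beta>"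
  shows "(\<Sum>q<d. \<Sum>p<d. (cmod (\<Sum>s<d. \<Sum>a<d. wroot d (p * s) * cnj (wroot d (p * a)) *
      M (s, a) ((s + q) mod d, (a + q) mod d)))\<^sup>2) \<le> real d * \<beta> * (\<Sum>i\<in>{..<d} \<times> {..<d}. Re (M i i))"
proof (cases "d = 0")
  case False
  then have d: "d > 0" by simp
  define C where "C r k l = M ((r + k) mod d, k) ((r + l) mod d, l)" for r k l
  define G where "G q r = (\<Sum>k<d. C r k ((k + q) mod d))" for q r
  \<comment> \<open>The substitution \<open>s = r + a\<close> groups the pairs by their difference
    \<open>r\<close>. The phases in \<open>a\<close> cancel, and what remains is a Fourier transform
    in \<open>r\<close> of sums taken inside the blocks \<open>C r\<close>.\<close>
  have t: "(\<Sum>s<d. \<Sum>a<d. wroot d (p * s) * cnj (wroot d (p * a)) *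
      M (s, a) ((s + q) mod d, (a + q) mod d)) = (\<Sum>r<d. wroot d (p * r) * G q r)" for p q
  proof -
    have "(\<Sum>s<d. \<Sum>a<d. wroot d (p * s) * cnj (wroot d (p * a)) * M (s, a) ((s + q) mod d, (a + q) mod d))
        = (\<Sum>a<d. \<Sum>s<d. wroot d (p * s) * cnj (wroot d (p * a)) * M (s, a) ((s + q) mod d, (a + q) mod d))"
      by (rule sum.swap)
    also have "\<dots> = (\<Sum>a<d. \<Sum>r<d. wroot d (p * ((r + a) mod d)) * cnj (wroot d (p * a)) *
        M ((r + a) mod d, a) (((r + a) mod d + q) mod d, (a + q) mod d))"
      by (intro sum.cong refl sum_shift'[symmetric])
    also have "\<dots> = (\<Sum>a<d. \<Sum>r<d. wroot d (p * r) * C r a ((a + q) mod d))"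
    proof (intro sum.cong refl)
      fix a r
      have "wroot d (p * ((r + a) mod d)) * cnj (wroot d (p * a)) = wroot d (p * r)"
        by (simp add: wroot_mod[OF d] distrib_left wroot_add wroot_cnj mult.assoc)
      moreover have "((r + a) mod d + q) mod d = (r + (a + q) mod d) mod d"
        by (simp add: mod_simps add.assoc)
      ultimately show "wroot d (p * ((r + a) mod d)) * cnj (wroot d (p * a)) *
          M ((r + a) mod d, a) (((r + a) mod d + q) mod d, (a + q) mod d) =
          wroot d (p * r) * C r a ((a + q) mod d)"
        by (simp add: C_def)
    qed
    also have "\<dots> = (\<Sum>r<d. wroot d (p * r) * G q r)"
      unfolding G_def by (subst sum.swap) (simp add: sum_distrib_left)
    finally show ?thesis .
  qed
  have C: "hpos {..<d} (C r)" for r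
    unfolding C_def using d
    by (intro hpos_compress[OF M, of _ "\<lambda>k. ((r + k) mod d, k)"]) (auto simp: inj_on_def)
  have "(\<Sum>q<d. \<Sum>p<d. (cmod (\<Sum>s<d. \<Sum>a<d. wroot d (p * s) * cnj (wroot d (p * a)) *
      M (s, a) ((s + q) mod d, (a + q) mod d)))\<^sup>2) = (\<Sum>q<d. real d * (\<Sum>r<d. (cmod (G q r))\<^sup>2))"
    unfolding t by (intro sum.cong refl parseval)
  also have "\<dots> = real d * (\<Sum>r<d. \<Sum>q<d. (cmod (G q r))\<^sup>2)"
    by (subst sum.swap) (simp only: sum_distrib_left)
  \<comment> \<open>Each block \<open>C r\<close> is a principal submatrix of \<open>M\<close> to
    which \<open>circulant_sums_le\<close> applies; the traces of the blocks add up to the trace of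
    \<open>M\<close>.\<close>
  also have "\<dots> \<le> real d * (\<Sum>r<d. \<beta> * (\<Sum>k<d. Re (C r k k)))"
    unfolding G_def using bound
    by (intro mult_left_mono sum_mono circulant_sums_le C) (simp_all add: C_def)
  also have "(\<Sum>r<d. \<beta> * (\<Sum>k<d. Re (C r k k))) = \<beta> * (\<Sum>k<d. \<Sum>r<d. Re (C r k k))"
    by (subst sum.swap) (simp only: sum_distrib_left)
  also have "(\<Sum>k<d. \<Sum>r<d. Re (C r k k)) = (\<Sum>k<d. \<Sum>s<d. Re (M (s, k) (s, k)))"
    unfolding C_def by (intro sum.cong refl sum_shift')
  also have "\<dots> = (\<Sum>i\<in>{..<d} \<times> {..<d}. Re (M i i))"
    by (subst sum.swap) (simp add: sum.cartesian_product split_def)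
  finally show ?thesis by (simp add: mult.assoc)
qed simp

text \<open>Parseval in \<open>p\<close> removes the phases, and as \<open>q\<close> varies every
  entry of \<open>A\<close> is reached exactly once; what is left is \<open>d\<close> times the
  squared Frobenius norm.\<close>

lemma local_sums_le:
  assumes A: "hpos {..<d} A"
  shows "(\<Sum>q<d. \<Sum>p<d. (cmod (\<Sum>s<d. wroot d (p * s) * A s ((s + q) mod d)))\<^sup>2)
      \<le> real d * (\<Sum>s<d. Re (A s s))\<^sup>2"
proof -
  have "(\<Sum>q<d. \<Sum>p<d. (cmod (\<Sum>s<d. wroot d (p * s) * A s ((s + q) mod d)))\<^sup>2)
      = real d * (\<Sum>q<d. \<Sum>s<d. (cmod (A s ((s + q) mod d)))\<^sup>2)"
    by (simp only: parseval sum_distrib_left)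
  also have "(\<Sum>q<d. \<Sum>s<d. (cmod (A s ((s + q) mod d)))\<^sup>2) = (\<Sum>s<d. \<Sum>q<d. (cmod (A s ((s + q) mod d)))\<^sup>2)"
    by (rule sum.swap)
  also have "\<dots> = (\<Sum>s<d. \<Sum>q<d. (cmod (A s q))\<^sup>2)"
    by (intro sum.cong refl sum_shift)
  also have "real d * \<dots> \<le> real d * (\<Sum>s<d. Re (A s s))\<^sup>2"
    by (intro mult_left_mono hpos_frobenius_le[OF A]) auto
  finally show ?thesis .
qed

section \<open>Matrices on the bipartite space\<close>

text \<open>The passage from matrices to kernels. Kernels can be indexed by pairs, restricted and
  relabelled without choosing a new matrix encoding.\<close>

lemma psd_iff_hpos:
  "psd n A \<longleftrightarrow> A \<in> carrier_mat n n \<and> hpos {..<n} (\<lambda>i j. A $$ (i, j))"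
proof (cases "A \<in> carrier_mat n n")
  case A: True
  have adj: "mat_adjoint A = A \<longleftrightarrow> (\<forall>i\<in>{..<n}. \<forall>j\<in>{..<n}. A $$ (j, i) = cnj (A $$ (i, j)))"
  proof -
    have idx: "mat_adjoint A $$ (j, i) = cnj (A $$ (i, j))" if "i < n" "j < n" for i j
      using A that by (simp add: mat_adjoint_def mat_of_rows_index)
    have "mat_adjoint A \<in> carrier_mat n n" using A by (auto simp: mat_adjoint_def)
    then have "mat_adjoint A = A \<longleftrightarrow> (\<forall>i<n. \<forall>j<n. mat_adjoint A $$ (j, i) = A $$ (j, i))"
      using A by (auto intro!: eq_matI)
    also have "\<dots> \<longleftrightarrow> (\<forall>i\<in>{..<n}. \<forall>j\<in>{..<n}. A $$ (j, i) = cnj (A $$ (i, j)))"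
      by (intro iffI ballI allI impI) (metis idx lessThan_iff)+
    finally show ?thesis .
  qed
  have form: "(A *\<^sub>v vec n v) \<bullet>c vec n v = (\<Sum>i<n. \<Sum>j<n. cnj (v i) * A $$ (i, j) * v j)" for v
  proof -
    have "(A *\<^sub>v vec n v) \<bullet>c vec n v = (\<Sum>i<n. (\<Sum>j<n. A $$ (i, j) * v j) * cnj (v i))"
      using A by (simp add: scalar_prod_def atLeast0LessThan)
    also have "\<dots> = (\<Sum>i<n. \<Sum>j<n. cnj (v i) * A $$ (i, j) * v j)"
      by (simp add: sum_distrib_left sum_distrib_right mult_ac)
    finally show ?thesis .
  qed
  have quad: "(\<forall>v\<in>carrier_vec n. 0 \<le> (A *\<^sub>v v) \<bullet>c v) \<longleftrightarrow>
      (\<forall>v. 0 \<le> (\<Sum>i<n. \<Sum>j<n. cnj (v i) * A $$ (i, j) * v j))"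
  proof -
    have "carrier_vec n = range (vec n :: (nat \<Rightarrow> complex) \<Rightarrow> _)"
    proof (intro subset_antisym subsetI)
      fix v :: "complex vec" assume "v \<in> carrier_vec n"
      then have "v = vec n (\<lambda>i. v $ i)" by auto
      then show "v \<in> range (vec n)" by (metis rangeI)
    qed auto
    then show ?thesis by (simp add: form)
  qed
  show ?thesis
  proof
    assume "psd n A"
    then have "mat_adjoint A = A" "\<forall>v. 0 \<le> (\<Sum>i<n. \<Sum>j<n. cnj (v i) * A $$ (i, j) * v j)"
      unfolding psd_def quad by blast+
    then show "A \<in> carrier_mat n n \<and> hpos {..<n} (\<lambda>i j. A $$ (i, j))"
      using A unfolding adj hpos_def less_eq_complex_def by (simp only: zero_complex.sel) blast
  next
    assume "A \<in> carrier_mat n n \<and> hpos {..<n} (\<lambda>i j. A $$ (i, j))"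
    then have h: "hpos {..<n} (\<lambda>i j. A $$ (i, j))" ..
    have "0 \<le> (\<Sum>i<n. \<Sum>j<n. cnj (v i) * A $$ (i, j) * v j)" for v
      using hpos_form[OF h, of v] hpos_form_real[OF h, of v]
      unfolding less_eq_complex_def by (simp only: zero_complex.sel)
    moreover have "mat_adjoint A = A" unfolding adj using h unfolding hpos_def by blast
    ultimately show "psd n A" unfolding psd_def quad using A by blast
  qed
qed (simp add: psd_def)

text \<open>Entries of \<open>M\<close> addressed by pairs of basis labels, following the index
  convention of \<open>kron\<close>.\<close>

definition bimat :: "nat \<Rightarrow> complex mat \<Rightarrow> nat \<times> nat \<Rightarrow> nat \<times> nat \<Rightarrow> complex" where
  "bimat d M x y = M $$ (fst x * d + snd x, fst y * d + snd y)"

abbreviation square :: "nat \<Rightarrow> (nat \<times> nat) set" where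
  "square d \<equiv> {..<d} \<times> {..<d}"

lemma bij_pair_index: "bij_betw (\<lambda>x. fst x * d + snd x) (square d) {..<d * d}"
proof (intro bij_betwI[where g = "\<lambda>i. (i div d, i mod d)"])
  show "(\<lambda>x. fst x * d + snd x) \<in> square d \<rightarrow> {..<d * d}"
  proof
    fix x assume "x \<in> square d"
    then have "fst x + 1 \<le> d" "snd x < d" by auto
    then have "fst x * d + snd x < (fst x + 1) * d" "(fst x + 1) * d \<le> d * d" by (simp, intro mult_right_mono) auto
    then show "fst x * d + snd x \<in> {..<d * d}" by simp
  qed
next
  show "(\<lambda>i. (i div d, i mod d)) \<in> {..<d * d} \<rightarrow> square d"
    by (cases "d = 0") (auto simp: less_mult_imp_div_less)
qed auto

lemma sum_pair_index: "(\<Sum>i<d * d. f i) = (\<Sum>x\<in>square d. f (fst x * d + snd x))"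
  using sum.reindex_bij_betw[OF bij_pair_index, of f d] by simp

lemma hpos_bimat:
  assumes "psd (d * d) M"
  shows "hpos (square d) (bimat d M)"
proof -
  have "hpos (square d) (\<lambda>x y. M $$ (fst x * d + snd x, fst y * d + snd y))"
    using assms bij_pair_index[of d] unfolding psd_iff_hpos bij_betw_def
    by (intro hpos_compress[where g = "\<lambda>x. fst x * d + snd x" and I = "{..<d * d}"]) auto
  then show ?thesis unfolding bimat_def .
qed

lemma mat_trace_bimat:
  "M \<in> carrier_mat (d * d) (d * d) \<Longrightarrow> mat_trace M = (\<Sum>x\<in>square d. bimat d M x x)"
  by (simp add: mat_trace_def sum_pair_index bimat_def)

lemma bimat_kron:
  assumes "A \<in> carrier_mat d d" "B \<in> carrier_mat d d" "x \<in> square d" "y \<in> square d"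
  shows "bimat d (kron A B) x y = A $$ (fst x, fst y) * B $$ (snd x, snd y)"
proof -
  have "fst z * d + snd z < d * d" if "z \<in> square d" for z
    using bij_betwE[OF bij_pair_index] that by blast
  with assms show ?thesis by (auto simp: bimat_def kron_def)
qed

lemma kron_carrier:
  "A \<in> carrier_mat d d \<Longrightarrow> B \<in> carrier_mat d d \<Longrightarrow> kron A B \<in> carrier_mat (d * d) (d * d)"
  by (simp add: kron_def)

lemma mat_trace_mult_with_conj:
  assumes "M \<in> carrier_mat (d * d) (d * d)" "\<rho> \<in> carrier_mat d d"
  shows "mat_trace (M * with_conj \<rho>) =
    (\<Sum>x\<in>square d. \<Sum>y\<in>square d. bimat d M x y * (\<rho> $$ (fst y, fst x) * cnj (\<rho> $$ (snd y, snd x))))"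
proof -
  have W: "with_conj \<rho> \<in> carrier_mat (d * d) (d * d)"
    unfolding with_conj_def by (rule kron_carrier) (use assms in auto)
  have "mat_trace (M * with_conj \<rho>) = (\<Sum>i<d * d. \<Sum>j<d * d. M $$ (i, j) * with_conj \<rho> $$ (j, i))"
    using assms W by (simp add: mat_trace_def scalar_prod_def atLeast0LessThan)
  also have "\<dots> = (\<Sum>x\<in>square d. \<Sum>y\<in>square d. bimat d M x y * bimat d (with_conj \<rho>) y x)"
    by (simp add: sum_pair_index bimat_def)
  also have "\<dots> = (\<Sum>x\<in>square d. \<Sum>y\<in>square d. bimat d M x y * (\<rho> $$ (fst y, fst x) * cnj (\<rho> $$ (snd y, snd x))))"
    unfolding with_conj_def using assms by (intro sum.cong refl) (auto simp: bimat_kron)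
  finally show ?thesis .
qed

section \<open>Entries of the displacement operators\<close>

lemma mult_monomial_mat:
  fixes f :: "nat \<times> nat \<Rightarrow> complex"
  assumes "\<And>j. j < d \<Longrightarrow> g j < d"
  shows "mat d d f * mat d d (\<lambda>(i, j). if i = g j then c j else 0) = mat d d (\<lambda>(i, j). f (i, g j) * c j)"
proof (rule eq_matI)
  fix i j assume "i < dim_row (mat d d (\<lambda>(i, j). f (i, g j) * c j))" "j < dim_col (mat d d (\<lambda>(i, j). f (i, g j) * c j))"
  then have ij: "i < d" "j < d" by auto
  then have "(mat d d f * mat d d (\<lambda>(i, j). if i = g j then c j else 0)) $$ (i, j) =
      (\<Sum>k<d. f (i, k) * (if k = g j then c j else 0))"
    by (simp add: scalar_prod_def atLeast0LessThan)
  also have "\<dots> = (\<Sum>k<d. if k = g j then f (i, k) * c j else 0)"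
    by (intro sum.cong refl) simp
  also have "\<dots> = f (i, g j) * c j" using assms ij by simp
  finally show "(mat d d f * mat d d (\<lambda>(i, j). if i = g j then c j else 0)) $$ (i, j) =
      mat d d (\<lambda>(i, j). f (i, g j) * c j) $$ (i, j)" using ij by simp
qed auto

lemma shift_X_pow: "shift_X d ^\<^sub>m q = mat d d (\<lambda>(i, j). if i = (j + q) mod d then 1 else 0)"
proof (induction q)
  case 0
  show ?case by (rule eq_matI) (auto simp: shift_X_def)
next
  case (Suc q)
  show ?case unfolding pow_mat.simps Suc unfolding shift_X_def
    by (subst mult_monomial_mat) (auto intro!: eq_matI simp: mod_simps)
qed

lemma clock_Z_pow: "clock_Z d ^\<^sub>m p = mat d d (\<lambda>(i, j). if i = j then wroot d (p * j) else 0)"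
proof (induction p)
  case 0
  show ?case by (rule eq_matI) (auto simp: clock_Z_def)
next
  case (Suc p)
  show ?case unfolding pow_mat.simps Suc unfolding clock_Z_def wroot_def[symmetric]
    by (subst mult_monomial_mat) (auto intro!: eq_matI simp: wroot_add)
qed

lemma displacement_eq: "displacement d q p = cis (pi * real q * real p / real d) \<cdot>\<^sub>m
    mat d d (\<lambda>(i, j). if i = (j + q) mod d then wroot d (p * j) else 0)"
  unfolding displacement_def shift_X_pow clock_Z_pow
  by (subst mult_monomial_mat) (auto intro!: arg_cong2[where f = smult_mat] eq_matI)

lemma displacement_carrier: "displacement d q p \<in> carrier_mat d d"
  by (simp add: displacement_eq)

lemma displacement_index:
  assumes "i < d" "j < d"
  shows "displacement d q p $$ (i, j) =
    (if i = (j + q) mod d then cis (pi * real q * real p / real d) * wroot d (p * j) else 0)"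
  using assms by (simp add: displacement_eq)

section \<open>Perturbed maximally mixed states\<close>

text \<open>Conjugating the trace of \<open>M\<close> against an operator replaces that operator by
  its adjoint. Adjoint terms in an expansion thereby combine to real parts.\<close>

lemma hpos_cnj_sum:
  assumes "hpos I M"
  shows "cnj (\<Sum>x\<in>I. \<Sum>y\<in>I. M x y * f x y) = (\<Sum>x\<in>I. \<Sum>y\<in>I. M x y * cnj (f y x))"
proof -
  have "cnj (\<Sum>x\<in>I. \<Sum>y\<in>I. M x y * f x y) = (\<Sum>x\<in>I. \<Sum>y\<in>I. cnj (M x y) * cnj (f x y))"
    by (simp only: cnj_sum complex_cnj_mult)
  also have "\<dots> = (\<Sum>x\<in>I. \<Sum>y\<in>I. M y x * cnj (f x y))"
    by (intro sum.cong refl) (simp only: hpos_herm[OF assms, symmetric])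
  also have "\<dots> = (\<Sum>x\<in>I. \<Sum>y\<in>I. M x y * cnj (f y x))"
    by (rule sum.swap)
  finally show ?thesis .
qed

definition dherm :: "nat \<Rightarrow> complex \<Rightarrow> nat \<Rightarrow> nat \<Rightarrow> nat \<Rightarrow> nat \<Rightarrow> complex" where
  "dherm d z q p i j =
     (z * displacement d q p $$ (i, j) + cnj (z * displacement d q p $$ (j, i))) / 2"

text \<open>For \<open>t = 0\<close> this is the maximally mixed state, written \<open>dstate d 0 1 0 0\<close> below.\<close>

definition dstate :: "nat \<Rightarrow> real \<Rightarrow> complex \<Rightarrow> nat \<Rightarrow> nat \<Rightarrow> complex mat" where
  "dstate d t z q p =
     mat d d (\<lambda>(i, j). ((if i = j then 1 else 0) + of_real t * dherm d z q p i j) / of_nat d)"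

lemma dstate_carrier: "dstate d t z q p \<in> carrier_mat d d"
  by (simp add: dstate_def)

lemma dherm_cnj: "cnj (dherm d z q p i j) = dherm d z q p j i"
  by (simp add: dherm_def add.commute)

text \<open>The real part of the trace of \<open>A H\<close>. Expectations of \<open>H^*\<close> are
  also of this form with \<open>A\<close> transposed, because \<open>H^*\<close> is the transpose of
  \<open>H\<close>.\<close>

definition local_obs :: "nat \<Rightarrow> complex \<Rightarrow> nat \<Rightarrow> nat \<Rightarrow> (nat \<Rightarrow> nat \<Rightarrow> complex) \<Rightarrow> real" where
  "local_obs d z q p A = Re (\<Sum>i<d. \<Sum>j<d. A i j * dherm d z q p j i)"

text \<open>The expectation of \<open>H \<otimes> H^*\<close>; exchanging the indices of the second
  factor conjugates it, since \<open>H\<close> is Hermitian.\<close>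

definition joint_obs :: "nat \<Rightarrow> complex \<Rightarrow> nat \<Rightarrow> nat \<Rightarrow> (nat \<times> nat \<Rightarrow> nat \<times> nat \<Rightarrow> complex) \<Rightarrow> real" where
  "joint_obs d z q p M = Re (\<Sum>x\<in>square d. \<Sum>y\<in>square d.
     M x y * (dherm d z q p (fst y) (fst x) * dherm d z q p (snd x) (snd y)))"

lemma sum_square: "(\<Sum>x\<in>square d. g x) = (\<Sum>i<d. \<Sum>a<d. g (i, a))"
  by (simp add: sum.cartesian_product)

lemma sum_pair_delta_snd:
  "(\<Sum>x\<in>square d. \<Sum>y\<in>square d. M x y * (f (fst x) (fst y) * (if snd y = snd x then 1 else 0))) =
    (\<Sum>i<d. \<Sum>j<d. (\<Sum>a<d. M (i, a) (j, a)) * f i j)" for M :: "_ \<Rightarrow> _ \<Rightarrow> complex"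
proof -
  have "(\<Sum>x\<in>square d. \<Sum>y\<in>square d. M x y * (f (fst x) (fst y) * (if snd y = snd x then 1 else 0))) =
    (\<Sum>i<d. \<Sum>a<d. \<Sum>j<d. \<Sum>b<d. if b = a then M (i, a) (j, b) * f i j else 0)"
    unfolding sum_square by (intro sum.cong refl) simp
  also have "\<dots> = (\<Sum>i<d. \<Sum>a<d. \<Sum>j<d. M (i, a) (j, a) * f i j)"
    by (intro sum.cong refl) simp
  also have "\<dots> = (\<Sum>i<d. \<Sum>j<d. \<Sum>a<d. M (i, a) (j, a) * f i j)"
    by (intro sum.cong refl sum.swap)
  finally show ?thesis by (simp add: sum_distrib_right)
qed

lemma sum_pair_delta_fst:
  "(\<Sum>x\<in>square d. \<Sum>y\<in>square d. M x y * ((if fst y = fst x then 1 else 0) * f (snd x) (snd y))) =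
    (\<Sum>a<d. \<Sum>b<d. (\<Sum>i<d. M (i, a) (i, b)) * f a b)" for M :: "_ \<Rightarrow> _ \<Rightarrow> complex"
proof -
  have "(\<Sum>x\<in>square d. \<Sum>y\<in>square d. M x y * ((if fst y = fst x then 1 else 0) * f (snd x) (snd y))) =
    (\<Sum>i<d. \<Sum>a<d. \<Sum>j<d. \<Sum>b<d. if j = i then M (i, a) (j, b) * f a b else 0)"
    unfolding sum_square by (intro sum.cong refl) simp
  also have "\<dots> = (\<Sum>i<d. \<Sum>a<d. \<Sum>b<d. M (i, a) (i, b) * f a b)"
    by (rule sum.cong[OF refl], rule sum.cong[OF refl], subst sum.swap, rule sum.cong[OF refl]) simp
  also have "\<dots> = (\<Sum>a<d. \<Sum>i<d. \<Sum>b<d. M (i, a) (i, b) * f a b)"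
    by (rule sum.swap)
  also have "\<dots> = (\<Sum>a<d. \<Sum>b<d. \<Sum>i<d. M (i, a) (i, b) * f a b)"
    by (intro sum.cong refl sum.swap)
  finally show ?thesis by (simp add: sum_distrib_right)
qed

lemma born_expansion:
  assumes d: "d > 0" and M: "M \<in> carrier_mat (d * d) (d * d)"
  shows "(real d)\<^sup>2 * Re (mat_trace (M * with_conj (dstate d t z q p))) =
    Re (mat_trace M)
    + t * local_obs d z q p (\<lambda>i j. \<Sum>a<d. bimat d M (i, a) (j, a))
    + t * local_obs d z q p (\<lambda>a b. \<Sum>i<d. bimat d M (i, b) (i, a))
    + t\<^sup>2 * joint_obs d z q p (bimat d M)"
proof -
  define h where "h = dherm d z q p"
  define \<delta> where "\<delta> i j = (if i = j then 1 else 0 :: complex)" for i j :: nat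
  have hc: "cnj (h i j) = h j i" for i j unfolding h_def by (rule dherm_cnj)
  have \<delta>c: "cnj (\<delta> i j) = \<delta> i j" for i j by (simp add: \<delta>_def)
  let ?B = "bimat d M"
  have expand: "b * ((e1 + of_real t * h1) * (e2 + of_real t * h2)) =
      b * (e1 * e2) + of_real t * (b * (h1 * e2)) + of_real t * (b * (e1 * h2)) + of_real (t\<^sup>2) * (b * (h1 * h2))"
    for b e1 e2 h1 h2 :: complex
    by (simp add: algebra_simps power2_eq_square)
  have "(of_nat d)\<^sup>2 * mat_trace (M * with_conj (dstate d t z q p)) =
    (\<Sum>x\<in>square d. \<Sum>y\<in>square d. ?B x y * ((\<delta> (fst y) (fst x) + of_real t * h (fst y) (fst x)) *
       (\<delta> (snd y) (snd x) + of_real t * h (snd x) (snd y))))"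
    unfolding mat_trace_mult_with_conj[OF M dstate_carrier] sum_distrib_left
  proof (intro sum.cong refl)
    fix x y assume "x \<in> square d" "y \<in> square d"
    then have "dstate d t z q p $$ (fst y, fst x) = (\<delta> (fst y) (fst x) + of_real t * h (fst y) (fst x)) / of_nat d"
      "cnj (dstate d t z q p $$ (snd y, snd x)) = (\<delta> (snd y) (snd x) + of_real t * h (snd x) (snd y)) / of_nat d"
      by (auto simp: dstate_def h_def \<delta>_def dherm_cnj)
    then show "(of_nat d)\<^sup>2 * (?B x y * (dstate d t z q p $$ (fst y, fst x) * cnj (dstate d t z q p $$ (snd y, snd x)))) =
      ?B x y * ((\<delta> (fst y) (fst x) + of_real t * h (fst y) (fst x)) *
       (\<delta> (snd y) (snd x) + of_real t * h (snd x) (snd y)))"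
      using d by (simp add: power2_eq_square)
  qed
  also have "\<dots> = (\<Sum>x\<in>square d. \<Sum>y\<in>square d. ?B x y * (\<delta> (fst y) (fst x) * \<delta> (snd y) (snd x)))
      + of_real t * (\<Sum>x\<in>square d. \<Sum>y\<in>square d. ?B x y * (h (fst y) (fst x) * \<delta> (snd y) (snd x)))
      + of_real t * (\<Sum>x\<in>square d. \<Sum>y\<in>square d. ?B x y * (\<delta> (fst y) (fst x) * h (snd x) (snd y)))
      + of_real (t\<^sup>2) * (\<Sum>x\<in>square d. \<Sum>y\<in>square d. ?B x y * (h (fst y) (fst x) * h (snd x) (snd y)))"
    by (simp only: expand sum.distrib sum_distrib_left)
  also have "(\<Sum>x\<in>square d. \<Sum>y\<in>square d. ?B x y * (\<delta> (fst y) (fst x) * \<delta> (snd y) (snd x))) = mat_trace M"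
    unfolding mat_trace_bimat[OF M]
  proof (intro sum.cong refl)
    fix x assume "x \<in> square d"
    then show "(\<Sum>y\<in>square d. ?B x y * (\<delta> (fst y) (fst x) * \<delta> (snd y) (snd x))) = ?B x x"
      by (subst sum.remove[of _ x]) (auto simp: \<delta>_def intro!: sum.neutral split: if_splits)
  qed
  also have "(\<Sum>x\<in>square d. \<Sum>y\<in>square d. ?B x y * (h (fst y) (fst x) * \<delta> (snd y) (snd x))) =
      (\<Sum>i<d. \<Sum>j<d. (\<Sum>a<d. ?B (i, a) (j, a)) * h j i)"
    unfolding \<delta>_def by (rule sum_pair_delta_snd)
  also have "(\<Sum>x\<in>square d. \<Sum>y\<in>square d. ?B x y * (\<delta> (fst y) (fst x) * h (snd x) (snd y))) =
      (\<Sum>a<d. \<Sum>b<d. (\<Sum>i<d. ?B (i, a) (i, b)) * h a b)"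
    unfolding \<delta>_def by (rule sum_pair_delta_fst)
  \<comment> \<open>Exchanging the two summation variables brings the term into the shape of
    \<open>local_obs\<close>, with the marginal transposed.\<close>
  also have "(\<Sum>a<d. \<Sum>b<d. (\<Sum>i<d. ?B (i, a) (i, b)) * h a b) = (\<Sum>a<d. \<Sum>b<d. (\<Sum>i<d. ?B (i, b) (i, a)) * h b a)"
    by (rule sum.swap)
  finally have "Re (of_real ((real d)\<^sup>2) * mat_trace (M * with_conj (dstate d t z q p))) =
    Re (mat_trace M + of_real t * (\<Sum>i<d. \<Sum>j<d. (\<Sum>a<d. ?B (i, a) (j, a)) * h j i)
      + of_real t * (\<Sum>a<d. \<Sum>b<d. (\<Sum>i<d. ?B (i, b) (i, a)) * h b a)
      + of_real (t\<^sup>2) * (\<Sum>x\<in>square d. \<Sum>y\<in>square d. ?B x y * (h (fst y) (fst x) * h (snd x) (snd y))))"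
    by simp
  then show ?thesis
    unfolding local_obs_def joint_obs_def h_def[symmetric] plus_complex.sel
    by (simp only: Re_complex_of_real Im_complex_of_real times_complex.sel mult_zero_left diff_zero)
qed

text \<open>For Hermitian \<open>A\<close> the trace of \<open>A H\<close> is the real part of the
  trace of \<open>A z D\<close>. The column structure of \<open>D\<close> leaves a single sum, and
  its constant phases drop out of the absolute value.\<close>

lemma local_obs_le:
  assumes A: "hpos {..<d} A" and z: "cmod z = 1"
  shows "\<bar>local_obs d z q p A\<bar> \<le> cmod (\<Sum>s<d. wroot d (p * s) * A s ((s + q) mod d))"
proof (cases "d = 0")
  case False
  let ?E = "\<lambda>i j. z * displacement d q p $$ (i, j)"
  define X where "X = (\<Sum>i<d. \<Sum>j<d. A i j * ?E j i)"
  have "(\<Sum>i<d. \<Sum>j<d. A i j * dherm d z q p j i) =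
      (X + (\<Sum>i<d. \<Sum>j<d. A i j * cnj (?E i j))) / 2"
    unfolding X_def dherm_def
    by (simp add: sum.distrib distrib_left sum_divide_distrib add_divide_distrib)
  also have "(\<Sum>i<d. \<Sum>j<d. A i j * cnj (?E i j)) = cnj X"
    unfolding X_def by (rule hpos_cnj_sum[OF A, symmetric])
  finally have "local_obs d z q p A = Re ((X + cnj X) / 2)"
    unfolding local_obs_def by (rule arg_cong)
  then have "local_obs d z q p A = Re X" by simp
  then have "\<bar>local_obs d z q p A\<bar> \<le> cmod X" by (simp add: abs_Re_le_cmod)
  also have "X = (\<Sum>s<d. \<Sum>j<d. if j = (s + q) mod d then
      z * cis (pi * real q * real p / real d) * (wroot d (p * s) * A s j) else 0)"
    unfolding X_def by (intro sum.cong refl) (simp add: displacement_index)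
  also have "\<dots> = z * cis (pi * real q * real p / real d) * (\<Sum>s<d. wroot d (p * s) * A s ((s + q) mod d))"
    using False by (simp add: sum_distrib_left)
  also have "cmod \<dots> = cmod (\<Sum>s<d. wroot d (p * s) * A s ((s + q) mod d))"
    using z by (simp add: norm_mult)
  finally show ?thesis .
qed (simp add: local_obs_def)

text \<open>The trace of \<open>M\<close> against \<open>D \<otimes> D^*\<close>; the scalar
  prefactor of \<open>D\<close> cancels against that of its conjugate.\<close>

definition bell_sum :: "nat \<Rightarrow> nat \<Rightarrow> nat \<Rightarrow> (nat \<times> nat \<Rightarrow> nat \<times> nat \<Rightarrow> complex) \<Rightarrow> complex" where
  "bell_sum d q p M = (\<Sum>s<d. \<Sum>a<d. wroot d (p * s) * cnj (wroot d (p * a)) *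
     M (s, a) ((s + q) mod d, (a + q) mod d))"

text \<open>Relabelling the second register by \<open>a \<mapsto> - a\<close> turns \<open>D\<^sup>T\<close> into a multiple of the entrywise
  conjugate of \<open>D\<close>, so the terms of \<open>H \<otimes> H\<^sup>*\<close> containing \<open>D \<otimes> D\<^sup>T\<close> are Bell sums of the
  reflected kernel.\<close>

definition reflect :: "nat \<Rightarrow> (nat \<times> nat \<Rightarrow> nat \<times> nat \<Rightarrow> complex) \<Rightarrow> nat \<times> nat \<Rightarrow> nat \<times> nat \<Rightarrow> complex" where
  "reflect d M x y = M (fst x, (d - snd x) mod d) (fst y, (d - snd y) mod d)"

lemma wroot_neg: assumes "k < d" shows "wroot d (p * ((d - k) mod d)) = cnj (wroot d (p * k))"
proof -
  have d: "d > 0" using assms by simp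
  have "p * (d - k) + p * k = d * p" using assms by (simp add: algebra_simps)
  then have 1: "wroot d (p * (d - k)) * wroot d (p * k) = 1"
    using wroot_mult_period[OF d, of p] by (simp flip: wroot_add)
  have "wroot d (p * (d - k)) = wroot d (p * (d - k)) * wroot d (p * k) * cnj (wroot d (p * k))"
    by (simp add: wroot_cnj mult.assoc)
  then show ?thesis using 1 by (simp add: wroot_mod[OF d])
qed

lemma sum_neg: "(\<Sum>k<d. f ((d - k) mod d)) = (\<Sum>k<d. f k)" for d :: nat
  by (rule sum.reindex_bij_betw[OF bij_neg])

text \<open>In residues this is \<open>- (b + q) + q = - b\<close>. Truncated subtraction is avoided
  by adding \<open>b\<close> on both sides and cancelling it through the injectivity of the
  shift.\<close>

lemma neg_shift_cancel:
  fixes b d :: nat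
  assumes "b < d"
  shows "((d - (b + q) mod d) mod d + q) mod d = (d - b) mod d"
proof -
  have d: "d > 0" using assms by simp
  have "(b + ((d - (b + q) mod d) mod d + q)) mod d = ((b + q) mod d + (d - (b + q) mod d)) mod d"
  proof -
    have "b + ((d - (b + q) mod d) mod d + q) = (b + q) + (d - (b + q) mod d) mod d" by simp
    then show ?thesis by (simp only: mod_add_left_eq mod_add_right_eq)
  qed
  also have "(b + q) mod d + (d - (b + q) mod d) = d"
    using d by (simp add: less_imp_le)
  finally have "(b + ((d - (b + q) mod d) mod d + q)) mod d = (b + (d - b)) mod d"
    using assms by simp
  then have "(b + ((d - (b + q) mod d) mod d + q) mod d) mod d = (b + (d - b) mod d) mod d"
    by (simp only: mod_add_right_eq)
  moreover have "inj_on (\<lambda>k. (b + k) mod d) {..<d}" using bij_shift by (rule bij_betw_imp_inj_on)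
  ultimately show ?thesis using d by (auto dest: inj_onD)
qed

lemma sum_delta2:
  fixes d :: nat
  assumes "i < d" "j < d"
  shows "(\<Sum>k<d. \<Sum>l<d. if k = i \<and> l = j then g k l else 0) = (g i j :: complex)"
proof -
  have "(\<Sum>k<d. \<Sum>l<d. if k = i \<and> l = j then g k l else 0) = (\<Sum>k<d. if k = i then g k j else 0)"
    using assms by (intro sum.cong refl) auto
  then show ?thesis using assms by simp
qed

text \<open>Expanding both Hermitian parts gives four products which form two adjoint pairs,
  represented by \<open>t1\<close> and \<open>t2\<close>. In \<open>t2\<close> the operator is
  \<open>z D \<otimes> (z D)^*\<close>, a Bell sum of \<open>M\<close>; in \<open>t1\<close> the
  second factor is the transpose of \<open>z D\<close>, which leads to the reflected kernel.\<close>

lemma joint_obs_le: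
  assumes M: "hpos (square d) M" and z: "cmod z = 1"
  shows "\<bar>joint_obs d z q p M\<bar> \<le> (cmod (bell_sum d q p M) + cmod (bell_sum d q p (reflect d M))) / 2"
proof (cases "d = 0")
  case False
  then have d: "d > 0" by simp
  define E where "E i j = z * displacement d q p $$ (i, j)" for i j
  define c where "c = z * cis (pi * real q * real p / real d)"
  have E: "E i j = (if i = (j + q) mod d then c * wroot d (p * j) else 0)" if "i < d" "j < d" for i j
    using that by (simp add: E_def c_def displacement_index)
  have nc: "cmod c = 1" using z by (simp add: c_def norm_mult)
  define f1 where "f1 x y = E (fst y) (fst x) * E (snd x) (snd y)" for x y
  define f2 where "f2 x y = E (fst y) (fst x) * cnj (E (snd y) (snd x))" for x y
  define t1 where "t1 = (\<Sum>x\<in>square d. \<Sum>y\<in>square d. M x y * f1 x y)"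
  define t2 where "t2 = (\<Sum>x\<in>square d. \<Sum>y\<in>square d. M x y * f2 x y)"
  have c1: "cnj t1 = (\<Sum>x\<in>square d. \<Sum>y\<in>square d. M x y * cnj (f1 y x))"
    unfolding t1_def by (rule hpos_cnj_sum[OF M])
  have c2: "cnj t2 = (\<Sum>x\<in>square d. \<Sum>y\<in>square d. M x y * cnj (f2 y x))"
    unfolding t2_def by (rule hpos_cnj_sum[OF M])
  have expand: "M x y * (dherm d z q p (fst y) (fst x) * dherm d z q p (snd x) (snd y)) =
      (M x y * f1 x y + M x y * f2 x y + M x y * cnj (f2 y x) + M x y * cnj (f1 y x)) / 4" for x y
    by (simp add: dherm_def f1_def f2_def flip: E_def) (simp add: algebra_simps)
  have "joint_obs d z q p M = Re ((t1 + t2 + cnj t2 + cnj t1) / 4)"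
    unfolding joint_obs_def expand c1 c2 unfolding t1_def t2_def
    by (simp only: sum.distrib sum_divide_distrib[symmetric])
  also have "\<dots> = (Re t1 + Re t2) / 2" by simp
  finally have "\<bar>joint_obs d z q p M\<bar> \<le> (cmod t1 + cmod t2) / 2"
    using abs_Re_le_cmod[of t1] abs_Re_le_cmod[of t2] abs_triangle_ineq[of "Re t1" "Re t2"] by simp
  also have "t2 = (c * cnj c) * bell_sum d q p M"
  proof -
    have "t2 = (\<Sum>s<d. \<Sum>a<d. \<Sum>j<d. \<Sum>b<d. if j = (s + q) mod d \<and> b = (a + q) mod d then
        (c * cnj c) * (wroot d (p * s) * cnj (wroot d (p * a)) * M (s, a) (j, b)) else 0)"
      unfolding t2_def sum_square by (intro sum.cong refl) (simp add: f2_def E)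
    also have "\<dots> = (\<Sum>s<d. \<Sum>a<d. (c * cnj c) * (wroot d (p * s) * cnj (wroot d (p * a)) *
        M (s, a) ((s + q) mod d, (a + q) mod d)))"
      using d by (intro sum.cong refl sum_delta2) auto
    finally show ?thesis by (simp only: bell_sum_def sum_distrib_left)
  qed
  also have "cmod \<dots> = cmod (bell_sum d q p M)" using nc by (simp add: norm_mult)
  also have "t1 = c\<^sup>2 * cnj (wroot d (p * q)) * bell_sum d q p (reflect d M)"
  proof -
    have "t1 = (\<Sum>s<d. \<Sum>a<d. \<Sum>j<d. \<Sum>b<d. if a = (b + q) mod d \<and> j = (s + q) mod d then
        c\<^sup>2 * (wroot d (p * s) * wroot d (p * b) * M (s, a) (j, b)) else 0)"
      unfolding t1_def sum_square by (intro sum.cong refl) (simp add: f1_def E power2_eq_square)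
    also have "\<dots> = (\<Sum>s<d. \<Sum>b<d. \<Sum>a<d. \<Sum>j<d. if a = (b + q) mod d \<and> j = (s + q) mod d then
        c\<^sup>2 * (wroot d (p * s) * wroot d (p * b) * M (s, a) (j, b)) else 0)"
    proof (rule sum.cong[OF refl])
      fix s
      let ?g = "\<lambda>a j b. if a = (b + q) mod d \<and> j = (s + q) mod d then
        c\<^sup>2 * (wroot d (p * s) * wroot d (p * b) * M (s, a) (j, b)) else 0"
      have "(\<Sum>a<d. \<Sum>j<d. \<Sum>b<d. ?g a j b) = (\<Sum>a<d. \<Sum>b<d. \<Sum>j<d. ?g a j b)"
        by (rule sum.cong[OF refl], rule sum.swap)
      also have "\<dots> = (\<Sum>b<d. \<Sum>a<d. \<Sum>j<d. ?g a j b)" by (rule sum.swap)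
      finally show "(\<Sum>a<d. \<Sum>j<d. \<Sum>b<d. ?g a j b) = (\<Sum>b<d. \<Sum>a<d. \<Sum>j<d. ?g a j b)" .
    qed
    also have "\<dots> = (\<Sum>s<d. \<Sum>b<d. c\<^sup>2 * (wroot d (p * s) * wroot d (p * b) *
        M (s, (b + q) mod d) ((s + q) mod d, b)))"
      using d by (intro sum.cong refl sum_delta2) auto
    also have "\<dots> = (\<Sum>s<d. \<Sum>b<d. c\<^sup>2 * cnj (wroot d (p * q)) * (wroot d (p * s) * cnj (wroot d (p * b)) *
        reflect d M (s, b) ((s + q) mod d, (b + q) mod d)))"
    proof (rule sum.cong[OF refl])
      fix s
      let ?f = "\<lambda>b. c\<^sup>2 * (wroot d (p * s) * wroot d (p * b) * M (s, (b + q) mod d) ((s + q) mod d, b))"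
      \<comment> \<open>Substituting \<open>- (b + q)\<close> for \<open>b\<close> turns the second
        labels \<open>b + q\<close> and \<open>b\<close> into \<open>- b\<close> and
        \<open>- (b + q)\<close>, as in \<open>reflect\<close>; the constant phase
        \<open>cnj (wroot d (p * q))\<close> splits off.\<close>
      have "(\<Sum>b<d. ?f b) = (\<Sum>b<d. ?f ((d - b) mod d))" by (rule sum_neg[symmetric])
      also have "\<dots> = (\<Sum>b<d. ?f ((d - (b + q) mod d) mod d))"
        by (rule sum_shift'[symmetric])
      also have "\<dots> = (\<Sum>b<d. c\<^sup>2 * cnj (wroot d (p * q)) * (wroot d (p * s) * cnj (wroot d (p * b)) *
        reflect d M (s, b) ((s + q) mod d, (b + q) mod d)))"
      proof (rule sum.cong[OF refl])
        fix b assume "b \<in> {..<d}"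
        then have b: "b < d" by simp
        have "wroot d (p * ((d - (b + q) mod d) mod d)) = cnj (wroot d (p * b)) * cnj (wroot d (p * q))"
          using d by (subst wroot_neg) (simp_all add: wroot_mod distrib_left wroot_add)
        then show "?f ((d - (b + q) mod d) mod d) = c\<^sup>2 * cnj (wroot d (p * q)) * (wroot d (p * s) *
            cnj (wroot d (p * b)) * reflect d M (s, b) ((s + q) mod d, (b + q) mod d))"
          by (simp add: neg_shift_cancel[OF b] reflect_def mult_ac)
      qed
      finally show "(\<Sum>b<d. ?f b) = (\<Sum>b<d. c\<^sup>2 * cnj (wroot d (p * q)) * (wroot d (p * s) *
        cnj (wroot d (p * b)) * reflect d M (s, b) ((s + q) mod d, (b + q) mod d)))" .
    qed
    finally show ?thesis by (simp only: bell_sum_def sum_distrib_left)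
  qed
  also have "cmod \<dots> = cmod (bell_sum d q p (reflect d M))" using nc by (simp add: norm_mult norm_power)
  finally show ?thesis by simp
qed (simp add: joint_obs_def bell_sum_def)

section \<open>Trace bounds for Bell and local sums, and the marginals of an effect\<close>

lemma hpos_reflect:
  assumes "hpos (square d) M" shows "hpos (square d) (reflect d M)"
proof -
  have "hpos (square d) (\<lambda>x y. M (fst x, (d - snd x) mod d) (fst y, (d - snd y) mod d))"
  proof (rule hpos_compress[OF assms])
    show "inj_on (\<lambda>x. (fst x, (d - snd x) mod d)) (square d)"
    proof (rule inj_onI)
      fix x y assume "x \<in> square d" "y \<in> square d"
        and eq: "(fst x, (d - snd x) mod d) = (fst y, (d - snd y) mod d)"
      then have "snd x = snd y"
        by (intro inj_onD[OF bij_betw_imp_inj_on[OF bij_neg[of d]], of "snd x" "snd y"]) auto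
      with eq show "x = y" by (simp add: prod_eq_iff)
    qed
    show "(\<lambda>x. (fst x, (d - snd x) mod d)) ` square d \<subseteq> square d"
      by (cases "d = 0") auto
  qed auto
  then show ?thesis unfolding reflect_def .
qed

lemma trace_reflect: "(\<Sum>x\<in>square d. Re (reflect d M x x)) = (\<Sum>x\<in>square d. Re (M x x))"
proof -
  have "(\<Sum>a<d. Re (M (s, (d - a) mod d) (s, (d - a) mod d))) = (\<Sum>a<d. Re (M (s, a) (s, a)))" for s
    by (rule sum_neg[where f = "\<lambda>a. Re (M (s, a) (s, a))"])
  then show ?thesis by (simp add: sum_square reflect_def)
qed

lemma bell_sum_norm_le:
  assumes "hpos (square d) M"
  shows "cmod (bell_sum d q p M) \<le> (\<Sum>x\<in>square d. Re (M x x))"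
proof -
  let ?f = "\<lambda>k. (k + q) mod d"
  have bij: "bij_betw ?f {..<d} {..<d}" using bij_shift[of q d] by (simp add: add.commute)
  have "cmod (bell_sum d q p M) \<le> (\<Sum>s<d. \<Sum>a<d. cmod (M (s, a) (?f s, ?f a)))"
    unfolding bell_sum_def
    by (intro sum_norm_le) (simp add: norm_mult)
  also have "\<dots> = (\<Sum>x\<in>square d. cmod (M x (map_prod ?f ?f x)))"
    by (simp add: sum_square)
  also have "\<dots> \<le> (\<Sum>x\<in>square d. Re (M x x))"
  proof (rule hpos_perm_sum_le[OF assms])
    show "bij_betw (map_prod ?f ?f) (square d) (square d)"
      using bij bij by (rule bij_betw_map_prod)
  qed simp
  finally show ?thesis .
qed

lemma local_sum_norm_le:
  assumes "hpos {..<d} A"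
  shows "cmod (\<Sum>s<d. wroot d (p * s) * A s ((s + q) mod d)) \<le> (\<Sum>s<d. Re (A s s))"
proof -
  have "cmod (\<Sum>s<d. wroot d (p * s) * A s ((s + q) mod d)) \<le> (\<Sum>s<d. cmod (A s ((s + q) mod d)))"
    by (intro sum_norm_le) (simp add: norm_mult)
  also have "\<dots> \<le> (\<Sum>s<d. Re (A s s))"
    using bij_shift[of q d] by (intro hpos_perm_sum_le[OF assms]) (simp_all add: add.commute)
  finally show ?thesis .
qed

lemma hpos_partial_trace_snd:
  assumes "hpos (square d) M" shows "hpos {..<d} (\<lambda>i j. \<Sum>a<d. M (i, a) (j, a))"
proof (rule hpos_sum)
  fix a assume "a \<in> {..<d}"
  then show "hpos {..<d} (\<lambda>i j. M (i, a) (j, a))"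
    using hpos_compress[OF assms, of "{..<d}" "\<lambda>i. (i, a)"] by (auto simp: inj_on_def)
qed

lemma hpos_partial_trace_fst:
  assumes "hpos (square d) M" shows "hpos {..<d} (\<lambda>a b. \<Sum>i<d. M (i, b) (i, a))"
proof (rule hpos_sum)
  fix i assume "i \<in> {..<d}"
  then have "hpos {..<d} (\<lambda>a b. M (i, a) (i, b))"
    using hpos_compress[OF assms, of "{..<d}" "\<lambda>a. (i, a)"] by (auto simp: inj_on_def)
  then show "hpos {..<d} (\<lambda>a b. M (i, b) (i, a))" by (rule hpos_transpose)
qed

text \<open>The coefficients \<open>c k\<close> placed on the pairs \<open>(g1 k, g2 k)\<close> form
  a maximally entangled vector of squared norm \<open>d\<close>. On it
  \<open>I \<otimes> \<sigma>\<close> takes the value \<open>1\<close>: different \<open>k\<close>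
  have different first labels, so off-diagonal terms vanish, and the second labels run through the
  whole trace of \<sigma>.\<close>

lemma loewner_graph_form_le:
  assumes M: "M \<in> carrier_mat (d * d) (d * d)" and tr: "mat_trace M = of_real T" "T > 0"
    and \<sigma>: "density_op d \<sigma>"
    and le: "loewner_le (d * d) ((1 / mat_trace M) \<cdot>\<^sub>m M) (complex_of_real K \<cdot>\<^sub>m kron (1\<^sub>m d) \<sigma>)"
    and g1: "bij_betw g1 {..<d} {..<d}" and g2: "bij_betw g2 {..<d} {..<d}"
    and c: "\<And>k. cmod (c k) = 1"
  shows "Re (\<Sum>k<d. \<Sum>l<d. cnj (c k) * bimat d M (g1 k, g2 k) (g1 l, g2 l) * c l) \<le> K * T"
proof -
  define F where "F = (\<Sum>k<d. \<Sum>l<d. cnj (c k) * bimat d M (g1 k, g2 k) (g1 l, g2 l) * c l)"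
  define D where "D = complex_of_real K \<cdot>\<^sub>m kron (1\<^sub>m d) \<sigma> - (1 / mat_trace M) \<cdot>\<^sub>m M"
  have \<sigma>c: "\<sigma> \<in> carrier_mat d d" and \<sigma>tr: "mat_trace \<sigma> = 1"
    using \<sigma> by (auto simp: density_op_def psd_def)
  have kc: "kron (1\<^sub>m d) \<sigma> \<in> carrier_mat (d * d) (d * d)" by (rule kron_carrier) (use \<sigma>c in auto)
  have g1m: "g1 k < d" and g2m: "g2 k < d" if "k < d" for k
    using bij_betwE[OF g1] bij_betwE[OF g2] that by auto
  have "hpos (square d) (bimat d D)"
    using le unfolding loewner_le_def D_def by (rule hpos_bimat)
  then have "hpos {..<d} (\<lambda>k l. bimat d D (g1 k, g2 k) (g1 l, g2 l))"
  proof (rule hpos_compress)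
    show "inj_on (\<lambda>k. (g1 k, g2 k)) {..<d}"
      using bij_betw_imp_inj_on[OF g1] by (auto simp: inj_on_def)
  qed (use g1m g2m in auto)
  then have "0 \<le> Re (\<Sum>k<d. \<Sum>l<d. cnj (c k) * bimat d D (g1 k, g2 k) (g1 l, g2 l) * c l)"
    by (rule hpos_form)
  also have "(\<Sum>k<d. \<Sum>l<d. cnj (c k) * bimat d D (g1 k, g2 k) (g1 l, g2 l) * c l) =
      (\<Sum>k<d. \<Sum>l<d. (if l = k then of_real K * \<sigma> $$ (g2 k, g2 k) else 0)
        - (cnj (c k) * bimat d M (g1 k, g2 k) (g1 l, g2 l) * c l) / of_real T)"
  proof (intro sum.cong refl)
    fix k l assume "k \<in> {..<d}" "l \<in> {..<d}"
    then have kl: "k < d" "l < d" by auto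
    have in_sq: "(g1 k, g2 k) \<in> square d" "(g1 l, g2 l) \<in> square d" using kl g1m g2m by auto
    then have idx: "g1 k * d + g2 k < d * d" "g1 l * d + g2 l < d * d"
      using bij_betwE[OF bij_pair_index[of d]] by fastforce+
    have "bimat d D (g1 k, g2 k) (g1 l, g2 l) =
      of_real K * bimat d (kron (1\<^sub>m d) \<sigma>) (g1 k, g2 k) (g1 l, g2 l) - bimat d M (g1 k, g2 k) (g1 l, g2 l) / of_real T"
      using M kc idx by (simp add: D_def bimat_def tr)
    also have "bimat d (kron (1\<^sub>m d) \<sigma>) (g1 k, g2 k) (g1 l, g2 l) = (if l = k then \<sigma> $$ (g2 k, g2 k) else 0)"
      using in_sq \<sigma>c kl inj_onD[OF bij_betw_imp_inj_on[OF g1], of k l] by (subst bimat_kron) auto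
    finally have eq: "bimat d D (g1 k, g2 k) (g1 l, g2 l) =
      of_real K * (if l = k then \<sigma> $$ (g2 k, g2 k) else 0) - bimat d M (g1 k, g2 k) (g1 l, g2 l) / of_real T" .
    have cc: "c k * cnj (c k) = 1" using c[of k] by (simp add: complex_norm_square[symmetric])
    show "cnj (c k) * bimat d D (g1 k, g2 k) (g1 l, g2 l) * c l =
      (if l = k then of_real K * \<sigma> $$ (g2 k, g2 k) else 0)
        - (cnj (c k) * bimat d M (g1 k, g2 k) (g1 l, g2 l) * c l) / of_real T"
      unfolding eq by (cases "l = k") (simp_all add: algebra_simps cc)
  qed
  also have "\<dots> = of_real K * (\<Sum>k<d. \<sigma> $$ (g2 k, g2 k)) - F / of_real T"
    unfolding F_def by (simp add: sum_subtractf sum_distrib_left flip: sum_divide_distrib)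
  also have "(\<Sum>k<d. \<sigma> $$ (g2 k, g2 k)) = (\<Sum>k<d. \<sigma> $$ (k, k))"
    by (rule sum.reindex_bij_betw[OF g2])
  also have "\<dots> = 1" using \<sigma>tr \<sigma>c by (simp add: mat_trace_def)
  finally have "0 \<le> K - Re F / T" by simp
  then show ?thesis using tr(2) unfolding F_def[symmetric] by (simp add: field_simps)
qed

text \<open>The vectors relevant to \<open>M\<close> live on the pairs \<open>(r + k, k)\<close>,
  those relevant to the reflected kernel on the pairs \<open>(r + k, - k)\<close>. In both families
  each coordinate is a permutation, so \<open>loewner_graph_form_le\<close> bounds both
  alike.\<close>

lemma bell_sums_bounded_le:
  assumes M: "psd (d * d) M" and tr: "mat_trace M = of_real T" "T > 0"
    and \<sigma>: "density_op d \<sigma>"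
    and le: "loewner_le (d * d) ((1 / mat_trace M) \<cdot>\<^sub>m M) (complex_of_real K \<cdot>\<^sub>m kron (1\<^sub>m d) \<sigma>)"
  shows "(\<Sum>q<d. \<Sum>p<d. (cmod (bell_sum d q p (bimat d M)))\<^sup>2) \<le> real d * K * T\<^sup>2"
    and "(\<Sum>q<d. \<Sum>p<d. (cmod (bell_sum d q p (reflect d (bimat d M))))\<^sup>2) \<le> real d * K * T\<^sup>2"
proof -
  have Mc: "M \<in> carrier_mat (d * d) (d * d)" using M by (simp add: psd_def)
  note h = hpos_bimat[OF M]
  note graph = loewner_graph_form_le[OF Mc tr \<sigma> le]
  have trace: "(\<Sum>x\<in>square d. Re (bimat d M x x)) = T"
    using arg_cong[OF mat_trace_bimat[OF Mc], of Re] tr by simp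
  have "(\<Sum>q<d. \<Sum>p<d. (cmod (bell_sum d q p (bimat d M)))\<^sup>2) \<le> real d * (K * T) * T"
    unfolding bell_sum_def trace[symmetric]
    by (rule bell_sums_le[OF h], unfold trace)
       (rule graph[OF bij_shift, of "\<lambda>k. k"], auto simp: bij_betw_def)
  then show "(\<Sum>q<d. \<Sum>p<d. (cmod (bell_sum d q p (bimat d M)))\<^sup>2) \<le> real d * K * T\<^sup>2"
    by (simp add: power2_eq_square mult.assoc)
  have "(\<Sum>q<d. \<Sum>p<d. (cmod (bell_sum d q p (reflect d (bimat d M))))\<^sup>2) \<le>
      real d * (K * T) * (\<Sum>x\<in>square d. Re (reflect d (bimat d M) x x))"
    unfolding bell_sum_def
  proof (rule bell_sums_le[OF hpos_reflect[OF h]])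
    fix r s
    show "Re (\<Sum>k<d. \<Sum>l<d. cnj (wroot d (s * k)) *
        reflect d (bimat d M) ((r + k) mod d, k) ((r + l) mod d, l) * wroot d (s * l)) \<le> K * T"
      unfolding reflect_def fst_conv snd_conv by (rule graph[OF bij_shift bij_neg]) simp
  qed
  then show "(\<Sum>q<d. \<Sum>p<d. (cmod (bell_sum d q p (reflect d (bimat d M))))\<^sup>2) \<le> real d * K * T\<^sup>2"
    unfolding trace_reflect trace by (simp add: power2_eq_square mult.assoc)
qed

section \<open>Divergence contributed by one effect\<close>

text \<open>Later \<open>1 + x\<close> is a likelihood ratio, which is kept at least
  \<open>1 / 8\<close>; this fixes the range of \<open>x\<close>.\<close>

lemma ln_quadratic_lower_bound:
  fixes x :: real
  assumes "x \<ge> - (7 / 8)"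
  shows "x - 4 * x\<^sup>2 \<le> ln (1 + x)"
proof -
  txt \<open>With \<open>s = sqrt (1 + x)\<close> and \<open>ln s \<ge> 1 - 1 / s\<close> the claim becomes a polynomial inequality in \<open>s\<close>.\<close>
  define s where "s = sqrt (1 + x)"
  have s2: "s\<^sup>2 = 1 + x" using assms by (simp add: s_def)
  \<comment> \<open>The rational \<open>7 / 20\<close> lies just below the square root of
    \<open>1 / 8\<close>.\<close>
  have "s \<ge> 7 / 20"
  proof (rule power2_le_imp_le)
    show "(7 / 20)\<^sup>2 \<le> s\<^sup>2" unfolding s2 using assms by (simp add: power2_eq_square)
  qed (use assms in \<open>simp add: s_def\<close>)
  then have s0: "s > 0" by simp
  have x: "x = s\<^sup>2 - 1" using s2 by simp
  have "ln (1 / s) \<le> 1 / s - 1" by (rule ln_le_minus_one) (use s0 in simp)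
  then have "ln s \<ge> 1 - 1 / s" using s0 by (simp add: ln_div)
  moreover have "ln (1 + x) = 2 * ln s"
    unfolding s2[symmetric] using s0 by (simp add: ln_realpow)
  ultimately have lnx: "ln (1 + x) \<ge> 2 * (1 - 1 / s)" by simp
  \<comment> \<open>Dividing the cubic \<open>4 * s * (s + 1)^2 - (s + 2)\<close> by
    \<open>s - 7 / 20\<close> gives this quotient, positive for positive \<open>s\<close>, and the
    positive remainder \<open>403 / 2000\<close>.\<close>
  have "0 \<le> (s - 7 / 20) * (4 * s\<^sup>2 + 47 / 5 * s + 629 / 100)"
    using \<open>s \<ge> 7 / 20\<close> by (intro mult_nonneg_nonneg) auto
  also have "\<dots> = 4 * s * (s + 1)\<^sup>2 - (s + 2) - 403 / 2000"
    by (simp add: power2_eq_square field_simps)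
  finally have "s + 2 \<le> 4 * s * (s + 1)\<^sup>2" by simp
  \<comment> \<open>Both sides of the target inequality, multiplied by \<open>s\<close>, share the
    factor \<open>(s - 1)^2\<close>: the functions agree to first order at
    \<open>s = 1\<close>.\<close>
  then have "(s - 1)\<^sup>2 * (s + 2) \<le> (s - 1)\<^sup>2 * (4 * s * (s + 1)\<^sup>2)"
    by (intro mult_left_mono) auto
  then have "(s * (s\<^sup>2 - 1) - 2 * (s - 1)) \<le> s * (4 * (s\<^sup>2 - 1)\<^sup>2)"
    by (simp add: power2_eq_square algebra_simps)
  then have "s * (x - 4 * x\<^sup>2) \<le> s * (2 * (1 - 1 / s))"
    using s0 unfolding x by (simp add: algebra_simps)
  then have "x - 4 * x\<^sup>2 \<le> 2 * (1 - 1 / s)" using s0 by simp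
  with lnx show ?thesis by simp
qed

lemma mean_le: "a \<le> c \<Longrightarrow> b \<le> c \<Longrightarrow> (a + b) / 2 \<le> c" for a b c :: real
  by simp

text \<open>\<open>H\<close>, its conjugate and \<open>H \<otimes> H^*\<close> have operator norm at
  most one, which shows here through sums of entries along permutations. These bounds keep the
  likelihood ratios away from zero.\<close>

lemma observables_le:
  assumes M: "psd (d * d) M" and T: "mat_trace M = of_real T" and z: "cmod z = 1"
  shows "\<bar>local_obs d z q p (\<lambda>i j. \<Sum>a<d. bimat d M (i, a) (j, a))\<bar> \<le> T"
    and "\<bar>local_obs d z q p (\<lambda>a b. \<Sum>i<d. bimat d M (i, b) (i, a))\<bar> \<le> T"
    and "\<bar>joint_obs d z q p (bimat d M)\<bar> \<le> T"
proof -
  have Mc: "M \<in> carrier_mat (d * d) (d * d)" using M by (simp add: psd_def)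
  note h = hpos_bimat[OF M]
  have trace: "(\<Sum>x\<in>square d. Re (bimat d M x x)) = T"
    using arg_cong[OF mat_trace_bimat[OF Mc], of Re] T by simp
  have "(\<Sum>i<d. Re (\<Sum>a<d. bimat d M (i, a) (i, a))) = T"
    using trace by (simp add: sum_square)
  then show "\<bar>local_obs d z q p (\<lambda>i j. \<Sum>a<d. bimat d M (i, a) (j, a))\<bar> \<le> T"
    using local_obs_le[OF hpos_partial_trace_snd[OF h] z, of q p]
      local_sum_norm_le[OF hpos_partial_trace_snd[OF h], of p q] by linarith
  have "(\<Sum>a<d. Re (\<Sum>i<d. bimat d M (i, a) (i, a))) = T"
    using trace unfolding sum_square Re_sum by (subst sum.swap)
  then show "\<bar>local_obs d z q p (\<lambda>a b. \<Sum>i<d. bimat d M (i, b) (i, a))\<bar> \<le> T"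
    using local_obs_le[OF hpos_partial_trace_fst[OF h] z, of q p]
      local_sum_norm_le[OF hpos_partial_trace_fst[OF h], of p q] by linarith
  show "\<bar>joint_obs d z q p (bimat d M)\<bar> \<le> T"
    using bell_sum_norm_le[OF h] bell_sum_norm_le[OF hpos_reflect[OF h]]
    unfolding trace_reflect trace by (intro order_trans[OF joint_obs_le[OF h z]] mean_le)
qed

text \<open>The phase \<open>z\<close> may vary with \<open>(q, p)\<close>, because each observable
  is bounded by the modulus of a sum free of \<open>z\<close>. The operator inequality enters only
  through the Bell sums.\<close>

lemma observables_square_sum_le:
  assumes M: "psd (d * d) M" and T: "mat_trace M = of_real T" "T > 0"
    and z: "\<And>q p. cmod (z q p) = 1"
    and \<sigma>: "density_op d \<sigma>"
    and le: "loewner_le (d * d) ((1 / mat_trace M) \<cdot>\<^sub>m M) (complex_of_real K \<cdot>\<^sub>m kron (1\<^sub>m d) \<sigma>)"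
  shows "(\<Sum>q<d. \<Sum>p<d. (local_obs d (z q p) q p (\<lambda>i j. \<Sum>a<d. bimat d M (i, a) (j, a)))\<^sup>2) \<le> real d * T\<^sup>2"
    and "(\<Sum>q<d. \<Sum>p<d. (local_obs d (z q p) q p (\<lambda>a b. \<Sum>i<d. bimat d M (i, b) (i, a)))\<^sup>2) \<le> real d * T\<^sup>2"
    and "(\<Sum>q<d. \<Sum>p<d. (joint_obs d (z q p) q p (bimat d M))\<^sup>2) \<le> real d * K * T\<^sup>2"
proof -
  have Mc: "M \<in> carrier_mat (d * d) (d * d)" using M by (simp add: psd_def)
  note h = hpos_bimat[OF M]
  have trace: "(\<Sum>x\<in>square d. Re (bimat d M x x)) = T"
    using arg_cong[OF mat_trace_bimat[OF Mc], of Re] T by simp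
  have loc: "(\<Sum>q<d. \<Sum>p<d. (local_obs d (z q p) q p A)\<^sup>2) \<le> real d * T\<^sup>2"
    if A: "hpos {..<d} A" and trA: "(\<Sum>s<d. Re (A s s)) = T" for A
  proof -
    have "(\<Sum>q<d. \<Sum>p<d. (local_obs d (z q p) q p A)\<^sup>2) \<le>
        (\<Sum>q<d. \<Sum>p<d. (cmod (\<Sum>s<d. wroot d (p * s) * A s ((s + q) mod d)))\<^sup>2)"
      using local_obs_le[OF A z] by (intro sum_mono) (metis abs_ge_zero power2_abs power_mono)
    also have "\<dots> \<le> real d * T\<^sup>2" using local_sums_le[OF A] trA by simp
    finally show ?thesis .
  qed
  have "(\<Sum>i<d. Re (\<Sum>a<d. bimat d M (i, a) (i, a))) = T"
    using trace by (simp add: sum_square)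
  then show "(\<Sum>q<d. \<Sum>p<d. (local_obs d (z q p) q p (\<lambda>i j. \<Sum>a<d. bimat d M (i, a) (j, a)))\<^sup>2) \<le> real d * T\<^sup>2"
    by (rule loc[OF hpos_partial_trace_snd[OF h]])
  have "(\<Sum>a<d. Re (\<Sum>i<d. bimat d M (i, a) (i, a))) = T"
    using trace unfolding sum_square Re_sum by (subst sum.swap)
  then show "(\<Sum>q<d. \<Sum>p<d. (local_obs d (z q p) q p (\<lambda>a b. \<Sum>i<d. bimat d M (i, b) (i, a)))\<^sup>2) \<le> real d * T\<^sup>2"
    by (rule loc[OF hpos_partial_trace_fst[OF h]])
  let ?a = "\<lambda>q p. cmod (bell_sum d q p (bimat d M))"
  let ?b = "\<lambda>q p. cmod (bell_sum d q p (reflect d (bimat d M)))"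
  have "(\<Sum>q<d. \<Sum>p<d. (joint_obs d (z q p) q p (bimat d M))\<^sup>2) \<le>
      (\<Sum>q<d. \<Sum>p<d. ((?a q p)\<^sup>2 + (?b q p)\<^sup>2) / 2)"
  proof (intro sum_mono)
    fix q p
    have "(joint_obs d (z q p) q p (bimat d M))\<^sup>2 \<le> ((?a q p + ?b q p) / 2)\<^sup>2"
      using joint_obs_le[OF h z] by (metis abs_ge_zero power2_abs power_mono)
    also have "\<dots> \<le> ((?a q p)\<^sup>2 + (?b q p)\<^sup>2) / 2"
      using zero_le_power2[of "?a q p - ?b q p"] by (simp add: power2_eq_square field_simps)
    finally show "(joint_obs d (z q p) q p (bimat d M))\<^sup>2 \<le> ((?a q p)\<^sup>2 + (?b q p)\<^sup>2) / 2" .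
  qed
  also have "\<dots> = ((\<Sum>q<d. \<Sum>p<d. (?a q p)\<^sup>2) + (\<Sum>q<d. \<Sum>p<d. (?b q p)\<^sup>2)) / 2"
    by (simp add: sum.distrib flip: sum_divide_distrib)
  also have "\<dots> \<le> real d * K * T\<^sup>2"
    by (intro mean_le bell_sums_bounded_le[OF M T \<sigma> le])
  finally show "(\<Sum>q<d. \<Sum>p<d. (joint_obs d (z q p) q p (bimat d M))\<^sup>2) \<le> real d * K * T\<^sup>2" .
qed

definition born :: "complex mat \<Rightarrow> complex mat \<Rightarrow> real" where
  "born M \<rho> = Re (mat_trace (M * with_conj \<rho>))"

lemma psd_trace:
  assumes "psd n M" obtains T where "mat_trace M = of_real T" "T \<ge> 0"
proof
  have h: "hpos {..<n} (\<lambda>i j. M $$ (i, j))" and c: "M \<in> carrier_mat n n"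
    using assms by (auto simp: psd_iff_hpos)
  show "mat_trace M = of_real (Re (mat_trace M))"
    using hpos_diag_real[OF h] c by (simp add: mat_trace_def complex_eq_iff)
  show "0 \<le> Re (mat_trace M)"
    using hpos_diag_nonneg[OF h] c by (auto simp: mat_trace_def intro: sum_nonneg)
qed

text \<open>The relative change of the probability is at most \<open>2 * t + t^2\<close> in modulus,
  hence at most \<open>7 / 8\<close>.\<close>

lemma born_lower:
  assumes d: "d > 0" and M: "psd (d * d) M" and z: "cmod z = 1" and t: "0 \<le> t" "2 * t + t\<^sup>2 \<le> 7 / 8"
  shows "born M (dstate d 0 1 0 0) / 8 \<le> born M (dstate d t z q p)"
    and "0 \<le> born M (dstate d 0 1 0 0)"
proof -
  obtain T where T: "mat_trace M = of_real T" "T \<ge> 0" using M by (rule psd_trace)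
  have Mc: "M \<in> carrier_mat (d * d) (d * d)" using M by (simp add: psd_def)
  define u where "u = local_obs d z q p (\<lambda>i j. \<Sum>a<d. bimat d M (i, a) (j, a))"
  define v where "v = local_obs d z q p (\<lambda>a b. \<Sum>i<d. bimat d M (i, b) (i, a))"
  define w where "w = joint_obs d z q p (bimat d M)"
  have uvw: "\<bar>u\<bar> \<le> T" "\<bar>v\<bar> \<le> T" "\<bar>w\<bar> \<le> T"
    unfolding u_def v_def w_def by (rule observables_le[OF M T(1) z])+
  have b0: "(real d)\<^sup>2 * born M (dstate d 0 1 0 0) = T"
    using born_expansion[OF d Mc, of 0 1 0 0] T by (simp add: born_def)
  have b: "(real d)\<^sup>2 * born M (dstate d t z q p) = T + t * u + t * v + t\<^sup>2 * w"
    using born_expansion[OF d Mc, of t z q p] T by (simp add: born_def u_def v_def w_def)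
  have "- (t * T) \<le> t * u" "- (t * T) \<le> t * v" "- (t\<^sup>2 * T) \<le> t\<^sup>2 * w"
    using uvw t mult_left_mono[of "- T" u t] mult_left_mono[of "- T" v t] mult_left_mono[of "- T" w "t\<^sup>2"] by auto
  moreover have "(2 * t + t\<^sup>2) * T \<le> 7 / 8 * T" using t T by (intro mult_right_mono)
  ultimately have "(real d)\<^sup>2 * (born M (dstate d 0 1 0 0) / 8) \<le> (real d)\<^sup>2 * born M (dstate d t z q p)"
    using b b0 by (simp add: algebra_simps)
  then show "born M (dstate d 0 1 0 0) / 8 \<le> born M (dstate d t z q p)" using d by simp
  have "0 \<le> (real d)\<^sup>2 * born M (dstate d 0 1 0 0)" using b0 T by simp
  then show "0 \<le> born M (dstate d 0 1 0 0)" using d by (simp add: zero_le_mult_iff)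
qed

text \<open>With \<open>b = b0 * (1 + e)\<close> the logarithmic bound gives
  \<open>b0 - b + 4 * b0 * e^2\<close>. The linear part \<open>b0 - b\<close> is kept, since it
  cancels only after summation over all effects of a measurement. The constant \<open>12\<close> is
  this \<open>4\<close> times the \<open>3\<close> from squaring a sum of three terms.\<close>

lemma effect_divergence_le:
  assumes d: "d > 0" and M: "psd (d * d) M" and z: "\<And>q p. cmod (z q p) = 1"
    and t: "0 \<le> t" "2 * t + t\<^sup>2 \<le> 7 / 8" and S: "S \<subseteq> square d"
    and bd: "0 < mat_trace M \<Longrightarrow> \<exists>\<sigma>. density_op d \<sigma> \<and>
      loewner_le (d * d) ((1 / mat_trace M) \<cdot>\<^sub>m M) (complex_of_real K \<cdot>\<^sub>m kron (1\<^sub>m d) \<sigma>)"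
  defines "b0 \<equiv> born M (dstate d 0 1 0 0)"
    and "b \<equiv> \<lambda>x. born M (dstate d t (z (fst x) (snd x)) (fst x) (snd x))"
  shows "(\<Sum>x\<in>S. b0 * ln (b0 / b x)) \<le> (\<Sum>x\<in>S. b0 - b x) + 12 * real d * (2 * t\<^sup>2 + t ^ 4 * K) * b0"
proof -
  obtain T where T: "mat_trace M = of_real T" "T \<ge> 0" using M by (rule psd_trace)
  have Mc: "M \<in> carrier_mat (d * d) (d * d)" using M by (simp add: psd_def)
  define u where "u q p = local_obs d (z q p) q p (\<lambda>i j. \<Sum>a<d. bimat d M (i, a) (j, a))" for q p
  define v where "v q p = local_obs d (z q p) q p (\<lambda>a b. \<Sum>i<d. bimat d M (i, b) (i, a))" for q p
  define w where "w q p = joint_obs d (z q p) q p (bimat d M)" for q p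
  have uvw: "\<bar>u q p\<bar> \<le> T" "\<bar>v q p\<bar> \<le> T" "\<bar>w q p\<bar> \<le> T" for q p
    unfolding u_def v_def w_def by (rule observables_le[OF M T(1) z])+
  have b0: "(real d)\<^sup>2 * b0 = T"
    using born_expansion[OF d Mc, of 0 1 0 0] T by (simp add: born_def b0_def)
  have bx: "(real d)\<^sup>2 * b (q, p) = T + t * u q p + t * v q p + t\<^sup>2 * w q p" for q p
    using born_expansion[OF d Mc, of t "z q p" q p] T by (simp add: born_def u_def v_def w_def b_def)
  show ?thesis
  proof (cases "T = 0")
    case True
    then have "u q p = 0" "v q p = 0" "w q p = 0" for q p using uvw[of q p] by auto
    then have "b x = 0" for x using bx[of "fst x" "snd x"] True d by simp
    moreover have "b0 = 0" using b0 True d by simp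
    ultimately show ?thesis by simp
  next
    case False
    with T have T0: "T > 0" by simp
    then have "0 < mat_trace M" using T by (simp add: less_complex_def)
    then obtain \<sigma> where \<sigma>: "density_op d \<sigma>"
      "loewner_le (d * d) ((1 / mat_trace M) \<cdot>\<^sub>m M) (complex_of_real K \<cdot>\<^sub>m kron (1\<^sub>m d) \<sigma>)"
      using bd by blast
    note sq = observables_square_sum_le[of d M T z, OF M T(1) T0 z \<sigma>, folded u_def v_def w_def]
    have b0p: "b0 > 0" using b0 T0 d by (metis zero_less_mult_pos zero_less_power of_nat_0_less_iff)
    define y where "y q p = (t\<^sup>2 * (u q p)\<^sup>2 + t\<^sup>2 * (v q p)\<^sup>2 + t ^ 4 * (w q p)\<^sup>2) / T\<^sup>2" for q p
    have pt: "b0 * ln (b0 / b x) \<le> (b0 - b x) + 12 * b0 * y (fst x) (snd x)" for x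
    proof -
      obtain q p where x: "x = (q, p)" by force
      define e where "e = (t * u q p + t * v q p + t\<^sup>2 * w q p) / T"
      have "T + t * u q p + t * v q p + t\<^sup>2 * w q p = T * (1 + e)"
        using T0 by (simp add: e_def field_simps)
      then have "(real d)\<^sup>2 * b x = (real d)\<^sup>2 * (b0 * (1 + e))"
        using bx[of q p] b0 by (simp add: x)
      then have be: "b x = b0 * (1 + e)" using d by simp
      have "b0 / 8 \<le> b x"
        unfolding b0_def b_def by (rule born_lower[OF d M z t])
      then have "b0 * (1 / 8) \<le> b0 * (1 + e)" by (simp add: be)
      then have e: "e \<ge> - (7 / 8)" using b0p by simp
      have "b0 / b x = 1 / (1 + e)" using b0p by (simp add: be)
      then have "b0 * ln (b0 / b x) = - b0 * ln (1 + e)" using e by (simp add: ln_div)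
      also have "\<dots> \<le> - b0 * (e - 4 * e\<^sup>2)"
        using ln_quadratic_lower_bound[OF e] b0p by simp
      also have "\<dots> = (b0 - b x) + 4 * b0 * e\<^sup>2" by (simp add: be algebra_simps)
      also have "e\<^sup>2 \<le> 3 * y q p"
      proof -
        have cs: "(\<alpha> + \<beta> + \<gamma>)\<^sup>2 \<le> 3 * (\<alpha>\<^sup>2 + \<beta>\<^sup>2 + \<gamma>\<^sup>2)" for \<alpha> \<beta> \<gamma> :: real
          using zero_le_power2[of "\<alpha> - \<beta>"] zero_le_power2[of "\<beta> - \<gamma>"] zero_le_power2[of "\<alpha> - \<gamma>"]
          by (simp add: power2_eq_square algebra_simps)
        have "(t * u q p + t * v q p + t\<^sup>2 * w q p)\<^sup>2 \<le>
            3 * (t\<^sup>2 * (u q p)\<^sup>2 + t\<^sup>2 * (v q p)\<^sup>2 + t ^ 4 * (w q p)\<^sup>2)"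
          using cs[of "t * u q p" "t * v q p" "t\<^sup>2 * w q p"] by (simp add: power_mult_distrib flip: power_mult)
        then show ?thesis unfolding e_def y_def
          by (simp add: power_divide divide_right_mono)
      qed
      finally show ?thesis using b0p by (simp add: x)
    qed
    \<comment> \<open>The terms are nonnegative, so the sum may be enlarged to the full square, over
      which the Parseval bounds are stated.\<close>
    have "(\<Sum>x\<in>S. y (fst x) (snd x)) \<le> (\<Sum>x\<in>square d. y (fst x) (snd x))"
      using S by (intro sum_mono2) (auto simp: y_def t)
    also have "\<dots> = (t\<^sup>2 * (\<Sum>q<d. \<Sum>p<d. (u q p)\<^sup>2) + t\<^sup>2 * (\<Sum>q<d. \<Sum>p<d. (v q p)\<^sup>2)
        + t ^ 4 * (\<Sum>q<d. \<Sum>p<d. (w q p)\<^sup>2)) / T\<^sup>2"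
      by (simp add: sum_square y_def sum.distrib sum_distrib_left flip: sum_divide_distrib)
    also have "\<dots> \<le> (t\<^sup>2 * (real d * T\<^sup>2) + t\<^sup>2 * (real d * T\<^sup>2) + t ^ 4 * (real d * K * T\<^sup>2)) / T\<^sup>2"
      using sq by (intro divide_right_mono add_mono mult_left_mono) auto
    also have "\<dots> = real d * (2 * t\<^sup>2 + t ^ 4 * K)"
      using T0 by (simp add: field_simps)
    finally have ysum: "(\<Sum>x\<in>S. y (fst x) (snd x)) \<le> real d * (2 * t\<^sup>2 + t ^ 4 * K)" .
    have "(\<Sum>x\<in>S. b0 * ln (b0 / b x)) \<le> (\<Sum>x\<in>S. (b0 - b x) + 12 * b0 * y (fst x) (snd x))"
      by (intro sum_mono pt)
    also have "\<dots> = (\<Sum>x\<in>S. b0 - b x) + 12 * b0 * (\<Sum>x\<in>S. y (fst x) (snd x))"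
      by (simp add: sum.distrib sum_distrib_left)
    also have "\<dots> \<le> (\<Sum>x\<in>S. b0 - b x) + 12 * b0 * (real d * (2 * t\<^sup>2 + t ^ 4 * K))"
      using ysum b0p by (intro add_left_mono mult_left_mono) auto
    finally show ?thesis by (simp add: mult_ac)
  qed
qed

section \<open>Separation of the perturbed states\<close>

text \<open>\<open>D\<close> is traceless unless \<open>q = p = 0\<close>: for \<open>q\<close>
  nonzero its diagonal is zero, and for \<open>q = 0\<close> the trace is a full sum of a nontrivial
  character. For \<open>t = 0\<close> the state does not involve \<open>D\<close>.\<close>

lemma sum_dstate_diag:
  assumes d: "d > 0" and qp: "q < d" "p < d" "t = 0 \<or> (q, p) \<noteq> (0, 0)"
  shows "(\<Sum>i<d. dstate d t z q p $$ (i, i)) = 1"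
proof -
  define D where "D = (\<Sum>i<d. displacement d q p $$ (i, i))"
  have "t = 0 \<or> D = 0"
  proof (cases "q = 0")
    case True
    have "D = (\<Sum>i<d. wroot d (i * p))"
      unfolding D_def using True by (intro sum.cong refl) (simp add: displacement_index mult.commute)
    then show ?thesis using wroot_sum[OF d, of p] qp True by (auto dest: nat_dvd_not_less)
  next
    case False
    have "i \<noteq> (i + q) mod d" if "i < d" for i
      using that qp False by (cases "i + q < d") (auto simp: mod_if)
    then show ?thesis unfolding D_def by (auto simp: displacement_index intro!: sum.neutral)
  qed
  moreover have "(\<Sum>i<d. dstate d t z q p $$ (i, i)) = 1 + of_real t * ((z * D + cnj (z * D)) / 2) / of_nat d"
    using d by (simp add: dstate_def dherm_def D_def sum.distrib add_divide_distrib distrib_left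
        sum_distrib_left sum_divide_distrib)
  ultimately show ?thesis by auto
qed

text \<open>This says that \<open>H\<close> has norm at most one: its form is the real part of the
  form of \<open>z D\<close>, which shifts the components of \<open>v\<close> and multiplies them by
  phases.\<close>

lemma dherm_form_le:
  assumes d: "d > 0" and z: "cmod z = 1"
  shows "\<bar>Re (\<Sum>i<d. \<Sum>j<d. cnj (v i) * dherm d z q p i j * v j)\<bar> \<le> (\<Sum>i<d. (cmod (v i))\<^sup>2)"
proof -
  define E where "E i j = z * displacement d q p $$ (i, j)" for i j
  define c where "c = z * cis (pi * real q * real p / real d)"
  have nc: "cmod c = 1" using z by (simp add: c_def norm_mult)
  define Y where "Y = (\<Sum>i<d. \<Sum>j<d. cnj (v i) * E i j * v j)"
  have "cnj Y = (\<Sum>i<d. \<Sum>j<d. cnj (v j) * cnj (E i j) * v i)"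
    unfolding Y_def by (simp add: mult_ac)
  also have "\<dots> = (\<Sum>i<d. \<Sum>j<d. cnj (v i) * cnj (E j i) * v j)" by (rule sum.swap)
  finally have cY: "cnj Y = (\<Sum>i<d. \<Sum>j<d. cnj (v i) * cnj (E j i) * v j)" .
  have expand: "cnj (v i) * dherm d z q p i j * v j = (cnj (v i) * E i j * v j + cnj (v i) * cnj (E j i) * v j) / 2" for i j
    by (simp add: dherm_def E_def algebra_simps)
  have "Re (\<Sum>i<d. \<Sum>j<d. cnj (v i) * dherm d z q p i j * v j) = Re ((Y + cnj Y) / 2)"
    unfolding expand cY unfolding Y_def by (simp only: sum.distrib sum_divide_distrib[symmetric])
  then have "\<bar>Re (\<Sum>i<d. \<Sum>j<d. cnj (v i) * dherm d z q p i j * v j)\<bar> \<le> cmod Y"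
    by (simp add: abs_Re_le_cmod)
  also have "Y = (\<Sum>j<d. \<Sum>i<d. cnj (v i) * E i j * v j)"
    unfolding Y_def by (rule sum.swap)
  also have "\<dots> = (\<Sum>j<d. \<Sum>i<d. if i = (j + q) mod d then cnj (v i) * (c * wroot d (p * j)) * v j else 0)"
    by (intro sum.cong refl) (simp add: E_def c_def displacement_index)
  also have "\<dots> = (\<Sum>j<d. cnj (v ((j + q) mod d)) * (c * wroot d (p * j)) * v j)"
    using d by simp
  also have "cmod \<dots> \<le> (\<Sum>j<d. ((cmod (v ((j + q) mod d)))\<^sup>2 + (cmod (v j))\<^sup>2) / 2)"
  proof (rule sum_norm_le)
    fix j
    show "cmod (cnj (v ((j + q) mod d)) * (c * wroot d (p * j)) * v j) \<le>
        ((cmod (v ((j + q) mod d)))\<^sup>2 + (cmod (v j))\<^sup>2) / 2"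
      using zero_le_power2[of "cmod (v ((j + q) mod d)) - cmod (v j)"] nc
      by (simp add: norm_mult power2_eq_square algebra_simps)
  qed
  also have "\<dots> = ((\<Sum>j<d. (cmod (v ((j + q) mod d)))\<^sup>2) + (\<Sum>j<d. (cmod (v j))\<^sup>2)) / 2"
    by (simp add: sum.distrib flip: sum_divide_distrib)
  also have "(\<Sum>j<d. (cmod (v ((j + q) mod d)))\<^sup>2) = (\<Sum>j<d. (cmod (v j))\<^sup>2)"
    by (rule sum_shift')
  finally show ?thesis by simp
qed

lemma density_dstate:
  assumes d: "d > 0" and qp: "q < d" "p < d" "t = 0 \<or> (q, p) \<noteq> (0, 0)" and z: "cmod z = 1"
    and t: "0 \<le> t" "t \<le> 1"
  shows "density_op d (dstate d t z q p)"
proof -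
  have "hpos {..<d} (\<lambda>i j. dstate d t z q p $$ (i, j))"
    unfolding hpos_def
  proof (intro conjI ballI allI)
    fix i j assume "i \<in> {..<d}" "j \<in> {..<d}"
    then show "dstate d t z q p $$ (j, i) = cnj (dstate d t z q p $$ (i, j))"
      by (auto simp: dstate_def dherm_cnj)
  next
    fix v :: "nat \<Rightarrow> complex"
    define H where "H = (\<Sum>i<d. \<Sum>j<d. cnj (v i) * dherm d z q p i j * v j)"
    have "(\<Sum>i<d. \<Sum>j<d. cnj (v i) * dstate d t z q p $$ (i, j) * v j) =
      (\<Sum>i<d. \<Sum>j<d. ((if j = i then cnj (v i) * v i else 0) + of_real t * (cnj (v i) * dherm d z q p i j * v j)) / of_nat d)"
      by (intro sum.cong refl) (auto simp: dstate_def algebra_simps)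
    also have "\<dots> = ((\<Sum>i<d. cnj (v i) * v i) + of_real t * H) / of_nat d"
      unfolding H_def by (simp add: sum.distrib sum_distrib_left flip: sum_divide_distrib)
    also have "(\<Sum>i<d. cnj (v i) * v i) = of_real (\<Sum>i<d. (cmod (v i))\<^sup>2)"
      by (simp only: of_real_sum complex_norm_square mult.commute)
    finally have "(\<Sum>i<d. \<Sum>j<d. cnj (v i) * dstate d t z q p $$ (i, j) * v j) =
      (of_real (\<Sum>i<d. (cmod (v i))\<^sup>2) + of_real t * H) / of_nat d" .
    then have eq: "Re (\<Sum>i<d. \<Sum>j<d. cnj (v i) * dstate d t z q p $$ (i, j) * v j) =
      ((\<Sum>i<d. (cmod (v i))\<^sup>2) + t * Re H) / real d"
      by (simp only: Re_divide_of_nat plus_complex.sel times_complex.sel Re_complex_of_real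
          Im_complex_of_real mult_zero_left diff_zero)
    have "\<bar>Re H\<bar> \<le> (\<Sum>i<d. (cmod (v i))\<^sup>2)" unfolding H_def by (rule dherm_form_le[OF d z])
    then have "t * \<bar>Re H\<bar> \<le> 1 * (\<Sum>i<d. (cmod (v i))\<^sup>2)" using t by (intro mult_mono) auto
    moreover have "- (t * \<bar>Re H\<bar>) \<le> t * Re H" using t by (simp add: abs_if mult_nonneg_nonpos)
    ultimately show "0 \<le> Re (\<Sum>i<d. \<Sum>j<d. cnj (v i) * dstate d t z q p $$ (i, j) * v j)"
      unfolding eq by (intro divide_nonneg_nonneg) auto
  qed
  then have "psd d (dstate d t z q p)" by (simp add: psd_iff_hpos dstate_carrier)
  moreover have "mat_trace (dstate d t z q p) = 1"
    using sum_dstate_diag[OF d qp, of z] by (simp add: mat_trace_def dstate_def)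
  ultimately show ?thesis by (simp add: density_op_def)
qed

text \<open>The identity cancels between the two signs, leaving \<open>2 * t / d\<close> times the
  trace of \<open>D H\<close>; the part of \<open>H\<close> with the adjoint of \<open>D\<close>
  contributes \<open>cnj z\<close>, as \<open>D\<close> is unitary.\<close>

lemma amplitude_dstate_diff:
  assumes d: "d > 0"
  shows "amplitude d (dstate d t z q p) q p - amplitude d (dstate d t (- z) q p) q p =
    of_real t * (z * (\<Sum>i<d. \<Sum>j<d. displacement d q p $$ (i, j) * displacement d q p $$ (j, i)) / of_nat d + cnj z)"
proof -
  let ?D = "\<lambda>i j. displacement d q p $$ (i, j)"
  have amp: "amplitude d (dstate d t y q p) q p = (\<Sum>i<d. \<Sum>j<d. ?D i j * dstate d t y q p $$ (j, i))" for y
    using displacement_carrier[of d q p] dstate_carrier[of d t y q p]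
    by (simp add: amplitude_def mat_trace_def scalar_prod_def atLeast0LessThan)
  have "amplitude d (dstate d t z q p) q p - amplitude d (dstate d t (- z) q p) q p =
      (\<Sum>i<d. \<Sum>j<d. of_real t / of_nat d * (z * (?D i j * ?D j i) + cnj z * (?D i j * cnj (?D i j))))"
    unfolding amp sum_subtractf[symmetric]
    by (intro sum.cong refl) (simp add: dstate_def dherm_def field_simps)
  also have "\<dots> = of_real t / of_nat d * (z * (\<Sum>i<d. \<Sum>j<d. ?D i j * ?D j i) +
      cnj z * (\<Sum>i<d. \<Sum>j<d. ?D i j * cnj (?D i j)))"
    by (simp only: distrib_left sum_distrib_left sum.distrib)
  also have "(\<Sum>i<d. \<Sum>j<d. ?D i j * cnj (?D i j)) = (\<Sum>j<d. \<Sum>i<d. ?D i j * cnj (?D i j))"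
    by (rule sum.swap)
  also have "\<dots> = (\<Sum>j<d. \<Sum>i<d. if i = (j + q) mod d then 1 else 0)"
    by (intro sum.cong refl)
      (auto simp: displacement_index complex_norm_square[symmetric] norm_mult simp del: complex_cnj_mult)
  also have "\<dots> = of_nat d" using d by simp
  finally show ?thesis using d by (simp add: field_simps)
qed

text \<open>The trace \<open>\<tau>\<close> of \<open>D\<^sup>2 / d\<close> need not vanish (for instance if \<open>2 q\<close> and \<open>2 p\<close> are multiples of \<open>d\<close>),
  but it can spoil the separation for at most one of the phases \<open>1\<close> and \<open>\<i>\<close>.\<close>

lemma exists_separated_phase:
  assumes d: "d > 0" and t: "t \<ge> 0"
  obtains z where "cmod z = 1"
    "t \<le> cmod (amplitude d (dstate d t z q p) q p - amplitude d (dstate d t (- z) q p) q p)"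
proof -
  define \<tau> where "\<tau> = (\<Sum>i<d. \<Sum>j<d. displacement d q p $$ (i, j) * displacement d q p $$ (j, i)) / of_nat d"
  have diff: "cmod (amplitude d (dstate d t z q p) q p - amplitude d (dstate d t (- z) q p) q p) = t * cmod (z * \<tau> + cnj z)" for z
    unfolding amplitude_dstate_diff[OF d] \<tau>_def using t by (simp add: norm_mult)
  \<comment> \<open>The phases \<open>1\<close> and \<open>\<i>\<close> give separations
    \<open>t * cmod (\<tau> + 1)\<close> and \<open>t * cmod (\<tau> - 1)\<close>, and the two
    moduli add up to at least \<open>2\<close>.\<close>
  have "2 = cmod ((\<tau> + 1) - (\<tau> - 1))" by simp
  also have "\<dots> \<le> cmod (\<tau> + 1) + cmod (\<tau> - 1)" by (rule norm_triangle_ineq4)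
  finally consider "1 \<le> cmod (\<tau> + 1)" | "1 \<le> cmod (\<tau> - 1)" by linarith
  then show ?thesis
  proof cases
    case 1
    show ?thesis by (rule that[of 1]) (use 1 t in \<open>simp_all only: diff\<close>, simp_all add: mult_le_cancel_left1)
  next
    case 2
    have "\<i> * \<tau> + cnj \<i> = \<i> * (\<tau> - 1)" by (simp add: algebra_simps)
    then have "cmod (\<i> * \<tau> + cnj \<i>) = cmod (\<tau> - 1)" by (simp add: norm_mult)
    then show ?thesis using 2 t by (intro that[of \<i>]) (simp_all add: diff mult_le_cancel_left1)
  qed
qed

section \<open>Adaptive records and their divergence\<close>

lemma records_0: "records P 0 = {[]}"
  by (auto simp: records_def)

lemma records_Suc:
  "records P (Suc m) = (\<lambda>(h, k). h @ [k]) ` (SIGMA h:records P m. outcomes P h)"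
proof (intro subset_antisym subsetI)
  fix os assume "os \<in> records P (Suc m)"
  then have l: "length os = Suc m" and o: "\<And>i. i < Suc m \<Longrightarrow> os ! i \<in> outcomes P (take i os)"
    by (auto simp: records_def)
  have "os = take m os @ [os ! m]" using l by (metis lessI order_refl take_Suc_conv_app_nth take_all)
  moreover have "take m os \<in> records P m"
    using l o by (auto simp: records_def min_def)
  moreover have "os ! m \<in> outcomes P (take m os)" using o by simp
  ultimately show "os \<in> (\<lambda>(h, k). h @ [k]) ` (SIGMA h:records P m. outcomes P h)"
    by (intro image_eqI[where x = "(take m os, os ! m)"]) auto
next
  fix os assume "os \<in> (\<lambda>(h, k). h @ [k]) ` (SIGMA h:records P m. outcomes P h)"
  then show "os \<in> records P (Suc m)"
    by (auto simp: records_def nth_append less_Suc_eq)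
qed

lemma sum_records_Suc:
  assumes "finite (records P m)" "\<And>h. h \<in> records P m \<Longrightarrow> finite (outcomes P h)"
  shows "(\<Sum>os\<in>records P (Suc m). f os) = (\<Sum>h\<in>records P m. \<Sum>k\<in>outcomes P h. f (h @ [k]))"
proof -
  have "inj_on (\<lambda>(h, k). h @ [k]) (SIGMA h:records P m. outcomes P h)"
    by (auto simp: inj_on_def)
  then show ?thesis
    unfolding records_Suc using assms by (simp add: sum.reindex sum.Sigma split_def)
qed

lemma record_prob_snoc: "record_prob P \<rho> (h @ [k]) = record_prob P \<rho> h * born (effect P h k) \<rho>"
  by (simp add: record_prob_def born_def nth_append)

lemma povm_born_sum:
  assumes "povm (d * d) K M" and \<rho>: "density_op d \<rho>"
  shows "(\<Sum>k\<in>K. born (M k) \<rho>) = 1"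
proof -
  have Mc: "M k \<in> carrier_mat (d * d) (d * d)" if "k \<in> K" for k
    using assms(1) that by (simp add: povm_def psd_def)
  have \<rho>c: "\<rho> \<in> carrier_mat d d" and tr: "(\<Sum>i<d. \<rho> $$ (i, i)) = 1"
    using \<rho> by (auto simp: density_op_def psd_def mat_trace_def)
  have total: "(\<Sum>k\<in>K. bimat d (M k) x y) = (if y = x then 1 else 0)" if "x \<in> square d" "y \<in> square d" for x y
  proof -
    define i j where "i = fst x * d + snd x" and "j = fst y * d + snd y"
    have ij: "i < d * d" "j < d * d"
      using bij_betwE[OF bij_pair_index[of d]] that by (auto simp: i_def j_def)
    have "i = j \<longleftrightarrow> x = y"
      using inj_onD[OF bij_betw_imp_inj_on[OF bij_pair_index[of d]], of x y] that by (auto simp: i_def j_def)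
    moreover have "(\<Sum>k\<in>K. M k $$ (i, j)) = 1\<^sub>m (d * d) $$ (i, j)"
    proof -
      have "mat (d * d) (d * d) (\<lambda>ij. \<Sum>k\<in>K. M k $$ ij) = 1\<^sub>m (d * d)"
        using assms(1) by (simp add: povm_def)
      from arg_cong[OF this, of "\<lambda>A. A $$ (i, j)"] show ?thesis using ij by simp
    qed
    ultimately show ?thesis using ij by (auto simp: bimat_def i_def j_def)
  qed
  have "(\<Sum>k\<in>K. mat_trace (M k * with_conj \<rho>)) =
    (\<Sum>k\<in>K. \<Sum>x\<in>square d. \<Sum>y\<in>square d. bimat d (M k) x y * (\<rho> $$ (fst y, fst x) * cnj (\<rho> $$ (snd y, snd x))))"
    by (intro sum.cong refl mat_trace_mult_with_conj Mc \<rho>c)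
  also have "\<dots> = (\<Sum>x\<in>square d. \<Sum>y\<in>square d. \<Sum>k\<in>K. bimat d (M k) x y * (\<rho> $$ (fst y, fst x) * cnj (\<rho> $$ (snd y, snd x))))"
    by (subst sum.swap) (intro sum.cong refl sum.swap)
  also have "\<dots> = (\<Sum>x\<in>square d. \<Sum>y\<in>square d. if y = x then \<rho> $$ (fst x, fst x) * cnj (\<rho> $$ (snd x, snd x)) else 0)"
    by (intro sum.cong refl) (simp add: total flip: sum_distrib_right)
  also have "\<dots> = (\<Sum>x\<in>square d. \<rho> $$ (fst x, fst x) * cnj (\<rho> $$ (snd x, snd x)))"
    by (intro sum.cong refl) simp
  also have "\<dots> = (\<Sum>i<d. \<rho> $$ (i, i)) * cnj (\<Sum>i<d. \<rho> $$ (i, i))"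
    unfolding sum_square by (simp add: sum_product)
  finally have "(\<Sum>k\<in>K. mat_trace (M k * with_conj \<rho>)) = 1" by (simp add: tr)
  then show ?thesis unfolding born_def by (simp flip: Re_sum)
qed

text \<open>Finiteness is carried through the induction together with the total, because splitting
  off the last round of the sum relies on it.\<close>

lemma records_total_prob:
  assumes "copywise_protocol d N P" "density_op d \<rho>" "m \<le> N"
  shows "finite (records P m) \<and> (\<Sum>os\<in>records P m. record_prob P \<rho> os) = 1"
  using assms(3)
proof (induction m)
  case 0
  show ?case by (simp add: records_0 record_prob_def)
next
  case (Suc m)
  then have IH: "finite (records P m)" "(\<Sum>os\<in>records P m. record_prob P \<rho> os) = 1" by auto
  have povm: "povm (d * d) (outcomes P h) (effect P h)" if "h \<in> records P m" for h
    using assms(1) that Suc.prems unfolding copywise_protocol_def by (meson Suc_le_lessD)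
  then have fin: "finite (outcomes P h)" if "h \<in> records P m" for h
    using that by (simp add: povm_def)
  have "finite (records P (Suc m))" using IH fin by (simp add: records_Suc)
  moreover have "(\<Sum>os\<in>records P (Suc m). record_prob P \<rho> os) =
      (\<Sum>h\<in>records P m. record_prob P \<rho> h * (\<Sum>k\<in>outcomes P h. born (effect P h k) \<rho>))"
    by (simp add: sum_records_Suc[OF IH(1) fin] record_prob_snoc sum_distrib_left)
  moreover have "\<dots> = (\<Sum>h\<in>records P m. record_prob P \<rho> h)"
    by (intro sum.cong refl) (simp add: povm_born_sum[OF povm assms(2)])
  ultimately show ?case using IH by simp
qed

text \<open>Data processing for the two-valued test \<open>E\<close>. The extreme case has
  probabilities \<open>1 / 2\<close> and \<open>2 / 3\<close>, where the binary divergence is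
  \<open>ln (9 / 8) / 2\<close>, at least \<open>1 / 18\<close>.\<close>

lemma divergence_event_lower_bound:
  fixes P Q :: "'a \<Rightarrow> real"
  assumes R: "finite R" and nn: "\<And>x. x \<in> R \<Longrightarrow> P x \<ge> 0" "\<And>x. x \<in> R \<Longrightarrow> Q x \<ge> 0"
    and ac: "\<And>x. x \<in> R \<Longrightarrow> P x > 0 \<Longrightarrow> Q x > 0"
    and total: "sum P R = 1" "sum Q R = 1" and E: "E \<subseteq> R" "sum P E \<le> 1 / 2" "sum Q E \<ge> 2 / 3"
  shows "1 / 18 \<le> (\<Sum>x\<in>R. P x * ln (P x / Q x))"
proof -
  \<comment> \<open>The concave function \<open>ln\<close> lies below its tangent at \<beta>,
    applied to the ratio \<open>Q x / P x\<close>.\<close>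
  have pt: "P x - Q x / \<beta> - P x * ln \<beta> \<le> P x * ln (P x / Q x)" if "x \<in> R" "\<beta> > 0" for x \<beta>
  proof (cases "P x = 0")
    case True
    then show ?thesis using nn(2)[OF that(1)] that(2) by simp
  next
    case False
    then have P: "P x > 0" using nn(1)[OF that(1)] by simp
    then have Q: "Q x > 0" using ac that by simp
    have "ln (Q x / (P x * \<beta>)) \<le> Q x / (P x * \<beta>) - 1"
      using P Q that by (intro ln_le_minus_one) simp
    then have "P x * (ln (Q x) - ln (P x) - ln \<beta>) \<le> P x * (Q x / (P x * \<beta>) - 1)"
      using P Q that by (intro mult_left_mono) (simp_all add: ln_div ln_mult)
    also have "\<dots> = Q x / \<beta> - P x" using P that by (simp add: field_simps)
    finally show ?thesis using P Q by (simp add: ln_div algebra_simps)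
  qed
  txt \<open>The tangent bound is used with \<open>\<beta> = Q / P\<close> for \<open>P E = 1 / 2\<close>, \<open>Q E = 2 / 3\<close>: that is \<open>4 / 3\<close> on \<open>E\<close> and
    \<open>2 / 3\<close> off \<open>E\<close>.\<close>
  have lnE: "ln (4 / 3 :: real) = ln 2 + ln (2 / 3)" using ln_mult[of 2 "2 / 3 :: real"] by simp
  \<comment> \<open>At the extreme probabilities the tangent bounds sum to
    \<open>- ln (8 / 9) / 2\<close>; this estimate of the logarithm turns that into
    \<open>1 / 18\<close>.\<close>
  have "ln (8 / 9 :: real) \<le> 8 / 9 - 1" by (rule ln_le_minus_one) simp
  moreover have "ln (8 / 9 :: real) = ln 2 + 2 * ln (2 / 3)"
    using ln_mult[of 2 "4 / 9 :: real"] ln_realpow[of "2 / 3 :: real" 2] by (simp add: power2_eq_square)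
  ultimately have ln89: "ln 2 + 2 * ln (2 / 3 :: real) \<le> - (1 / 9)" by simp
  have lin: "(\<Sum>x\<in>A. P x - Q x / b - P x * c) = sum P A - sum Q A / b - sum P A * c" for A b c
    by (simp add: sum_subtractf sum_distrib_right sum_divide_distrib)
  have "(\<Sum>x\<in>E. P x - Q x / (4 / 3) - P x * ln (4 / 3)) + (\<Sum>x\<in>R - E. P x - Q x / (2 / 3) - P x * ln (2 / 3))
      \<le> (\<Sum>x\<in>E. P x * ln (P x / Q x)) + (\<Sum>x\<in>R - E. P x * ln (P x / Q x))"
    using E by (intro add_mono sum_mono pt) auto
  also have "\<dots> = (\<Sum>x\<in>R. P x * ln (P x / Q x))"
    using sum.subset_diff[OF E(1) R, of "\<lambda>x. P x * ln (P x / Q x)"] by simp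
  finally have "(sum P E - sum Q E / (4 / 3) - sum P E * ln (4 / 3)) +
      (sum P (R - E) - sum Q (R - E) / (2 / 3) - sum P (R - E) * ln (2 / 3))
      \<le> (\<Sum>x\<in>R. P x * ln (P x / Q x))"
    unfolding lin .
  moreover have "sum P (R - E) = 1 - sum P E" "sum Q (R - E) = 1 - sum Q E"
    using sum.subset_diff[OF E(1) R, of P] sum.subset_diff[OF E(1) R, of Q] total by auto
  ultimately have "(sum P E - sum Q E / (4 / 3) - sum P E * (ln 2 + ln (2 / 3))) +
      ((1 - sum P E) - (1 - sum Q E) / (2 / 3) - (1 - sum P E) * ln (2 / 3))
      \<le> (\<Sum>x\<in>R. P x * ln (P x / Q x))"
    by (simp only: lnE)
  moreover have "sum P E * (ln 2 + ln (2 / 3)) + (1 - sum P E) * ln (2 / 3) = sum P E * ln 2 + ln (2 / 3)"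
    by (simp add: algebra_simps)
  moreover have "sum P E * ln 2 \<le> 1 / 2 * ln 2"
    using E(2) by (intro mult_right_mono) auto
  ultimately show ?thesis using E(3) ln89 by argo
qed

text \<open>The factorwise bound \<open>born_lower\<close> is multiplied along the record. The third
  claim is the absolute continuity that makes the divergence meaningful.\<close>

lemma record_prob_dstate_pos:
  assumes d: "d > 0" and P: "copywise_protocol d N P" and z: "cmod z = 1"
    and t: "0 \<le> t" "2 * t + t\<^sup>2 \<le> 7 / 8" and m: "m \<le> N" and h: "h \<in> records P m"
  shows "0 \<le> record_prob P (dstate d 0 1 0 0) h" "0 \<le> record_prob P (dstate d t z q p) h"
    "0 < record_prob P (dstate d 0 1 0 0) h \<longrightarrow> 0 < record_prob P (dstate d t z q p) h"
proof -
  have "0 \<le> record_prob P (dstate d 0 1 0 0) h \<and> 0 \<le> record_prob P (dstate d t z q p) h \<and>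
      (0 < record_prob P (dstate d 0 1 0 0) h \<longrightarrow> 0 < record_prob P (dstate d t z q p) h)"
    using m h
  proof (induction m arbitrary: h)
    case 0
    then show ?case by (simp add: records_0 record_prob_def)
  next
    case (Suc m)
    then obtain g k where hk: "h = g @ [k]" "g \<in> records P m" "k \<in> outcomes P g"
      unfolding records_Suc by auto
    have "povm (d * d) (outcomes P g) (effect P g)"
      using P hk(2) Suc.prems unfolding copywise_protocol_def by (meson Suc_le_lessD)
    then have M: "psd (d * d) (effect P g k)" using hk(3) by (simp add: povm_def)
    note b = born_lower(1)[OF d M z t, of q p] born_lower(2)[OF d M z t]
    have IH: "0 \<le> record_prob P (dstate d 0 1 0 0) g" "0 \<le> record_prob P (dstate d t z q p) g"
      "0 < record_prob P (dstate d 0 1 0 0) g \<longrightarrow> 0 < record_prob P (dstate d t z q p) g"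
      using Suc.IH[OF _ hk(2)] Suc.prems by auto
    have b': "0 \<le> born (effect P g k) (dstate d t z q p)"
      "0 < born (effect P g k) (dstate d 0 1 0 0) \<longrightarrow> 0 < born (effect P g k) (dstate d t z q p)"
      using b by linarith+
    show ?case
      unfolding hk(1) record_prob_snoc using IH b(2) b'
      by (auto simp: zero_less_mult_iff intro!: mult_nonneg_nonneg)
  qed
  then show "0 \<le> record_prob P (dstate d 0 1 0 0) h" "0 \<le> record_prob P (dstate d t z q p) h"
    "0 < record_prob P (dstate d 0 1 0 0) h \<longrightarrow> 0 < record_prob P (dstate d t z q p) h" by auto
qed

text \<open>By the chain rule each round adds its conditional divergence, averaged over the
  histories under the maximally mixed state. This average is the same for all \<open>(q, p)\<close>,
  so the sum over them can be taken inside it, where the bound \<open>B\<close> holds for every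
  history, whatever measurement was chosen there.\<close>

lemma total_divergence_le:
  assumes d: "d > 0" and P: "copywise_protocol d N P" "protocol_bounded d N \<eta> P"
    and z: "\<And>q p. cmod (z q p) = 1"
    and t: "0 \<le> t" "2 * t + t\<^sup>2 \<le> 7 / 8" and m: "m \<le> N"
  defines "S \<equiv> square d - {(0, 0)}"
    and "P0 \<equiv> record_prob P (dstate d 0 1 0 0)"
    and "Px \<equiv> \<lambda>x. record_prob P (dstate d t (z (fst x) (snd x)) (fst x) (snd x))"
    and "B \<equiv> 12 * real d * (2 * t\<^sup>2 + t ^ 4 * 2 powr \<eta>)"
  shows "(\<Sum>x\<in>S. \<Sum>os\<in>records P m. P0 os * ln (P0 os / Px x os)) \<le> real m * B"
  using m
proof (induction m)
  case 0
  show ?case by (simp add: records_0 record_prob_def P0_def Px_def)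
next
  case (Suc m)
  then have m: "m < N" by simp
  define b0 where "b0 h k = born (effect P h k) (dstate d 0 1 0 0)" for h k
  define b where "b x h k = born (effect P h k) (dstate d t (z (fst x) (snd x)) (fst x) (snd x))" for x h k
  have "t \<le> 1" using t zero_le_power2[of t] by linarith
  have dens0: "density_op d (dstate d 0 1 0 0)" by (rule density_dstate) (use d in auto)
  have dens: "density_op d (dstate d t (z (fst x) (snd x)) (fst x) (snd x))" if "x \<in> S" for x
    using that z t \<open>t \<le> 1\<close> d by (intro density_dstate) (auto simp: S_def prod_eq_iff)
  have povm: "povm (d * d) (outcomes P h) (effect P h)" if "h \<in> records P m" for h
    using P(1) m that unfolding copywise_protocol_def by blast
  have fin: "finite (outcomes P h)" if "h \<in> records P m" for h
    using povm[OF that] by (simp add: povm_def)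
  have psd: "psd (d * d) (effect P h k)" if "h \<in> records P m" "k \<in> outcomes P h" for h k
    using povm[OF that(1)] that(2) by (simp add: povm_def)
  have R: "finite (records P m)" "(\<Sum>h\<in>records P m. P0 h) = 1"
    using records_total_prob[OF P(1) dens0, of m] m by (auto simp: P0_def)
  have sum0: "(\<Sum>k\<in>outcomes P h. b0 h k) = 1" if "h \<in> records P m" for h
    unfolding b0_def by (rule povm_born_sum[OF povm[OF that] dens0])
  have sumx: "(\<Sum>k\<in>outcomes P h. b x h k) = 1" if "h \<in> records P m" "x \<in> S" for h x
    unfolding b_def by (rule povm_born_sum[OF povm[OF that(1)] dens[OF that(2)]])
  have step: "P0 (h @ [k]) * ln (P0 (h @ [k]) / Px x (h @ [k])) =
      P0 h * ln (P0 h / Px x h) * b0 h k + P0 h * (b0 h k * ln (b0 h k / b x h k))"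
    if h: "h \<in> records P m" and k: "k \<in> outcomes P h" for x h k
  proof (cases "P0 h = 0 \<or> b0 h k = 0")
    case True
    then show ?thesis by (auto simp: P0_def record_prob_snoc b0_def)
  next
    case False
    have P0: "P0 h > 0" and Px: "Px x h > 0"
      using record_prob_dstate_pos[OF d P(1) z t _ h] m False unfolding P0_def Px_def
      by (fastforce simp: less_le)+
    have "b0 h k > 0" and "b x h k > 0"
      using born_lower(1)[OF d psd[OF h k] z t, of "fst x" "snd x" "fst x" "snd x"]
        born_lower(2)[OF d psd[OF h k] z t] False
      unfolding b0_def b_def by linarith+
    then show ?thesis using P0 Px
      by (simp add: P0_def Px_def record_prob_snoc b0_def b_def ln_div ln_mult algebra_simps)
  qed
  have round: "(\<Sum>x\<in>S. \<Sum>k\<in>outcomes P h. b0 h k * ln (b0 h k / b x h k)) \<le> B"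
    if h: "h \<in> records P m" for h
  proof -
    have "(\<Sum>x\<in>S. \<Sum>k\<in>outcomes P h. b0 h k * ln (b0 h k / b x h k)) =
        (\<Sum>k\<in>outcomes P h. \<Sum>x\<in>S. b0 h k * ln (b0 h k / b x h k))"
      by (rule sum.swap)
    also have "\<dots> \<le> (\<Sum>k\<in>outcomes P h. (\<Sum>x\<in>S. b0 h k - b x h k) + B * b0 h k)"
    proof (rule sum_mono)
      fix k assume k: "k \<in> outcomes P h"
      show "(\<Sum>x\<in>S. b0 h k * ln (b0 h k / b x h k)) \<le> (\<Sum>x\<in>S. b0 h k - b x h k) + B * b0 h k"
        unfolding b0_def b_def B_def
      proof (rule effect_divergence_le[OF d psd[OF h k] z t])
        show "\<exists>\<sigma>. density_op d \<sigma> \<and> loewner_le (d * d) ((1 / mat_trace (effect P h k)) \<cdot>\<^sub>m effect P h k)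
            (complex_of_real (2 powr \<eta>) \<cdot>\<^sub>m kron (1\<^sub>m d) \<sigma>)" if "0 < mat_trace (effect P h k)"
          using P(2) m h k that unfolding protocol_bounded_def povm_bounded_def by blast
      qed (auto simp: S_def)
    qed
    also have "\<dots> = (\<Sum>k\<in>outcomes P h. \<Sum>x\<in>S. b0 h k - b x h k) + B * (\<Sum>k\<in>outcomes P h. b0 h k)"
      by (simp only: sum.distrib sum_distrib_left)
    also have "(\<Sum>k\<in>outcomes P h. \<Sum>x\<in>S. b0 h k - b x h k) = (\<Sum>x\<in>S. \<Sum>k\<in>outcomes P h. b0 h k - b x h k)"
      by (rule sum.swap)
    \<comment> \<open>The linear terms cancel: both families are probability distributions over the
      outcomes of the measurement.\<close>
    also have "\<dots> = 0"
      using sum0[OF h] sumx[OF h] by (intro sum.neutral) (simp add: sum_subtractf)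
    finally show ?thesis by (simp add: sum0[OF h])
  qed
  have inner: "(\<Sum>k\<in>outcomes P h. P0 (h @ [k]) * ln (P0 (h @ [k]) / Px x (h @ [k]))) =
      P0 h * ln (P0 h / Px x h) + P0 h * (\<Sum>k\<in>outcomes P h. b0 h k * ln (b0 h k / b x h k))"
    if h: "h \<in> records P m" for x h
  proof -
    have "(\<Sum>k\<in>outcomes P h. P0 (h @ [k]) * ln (P0 (h @ [k]) / Px x (h @ [k]))) =
      (\<Sum>k\<in>outcomes P h. P0 h * ln (P0 h / Px x h) * b0 h k + P0 h * (b0 h k * ln (b0 h k / b x h k)))"
      using step[OF h] by (intro sum.cong refl)
    also have "\<dots> = P0 h * ln (P0 h / Px x h) * (\<Sum>k\<in>outcomes P h. b0 h k) +
        P0 h * (\<Sum>k\<in>outcomes P h. b0 h k * ln (b0 h k / b x h k))"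
      by (simp only: sum.distrib sum_distrib_left)
    finally show ?thesis by (simp add: sum0[OF h])
  qed
  have "(\<Sum>x\<in>S. \<Sum>os\<in>records P (Suc m). P0 os * ln (P0 os / Px x os)) =
      (\<Sum>x\<in>S. \<Sum>h\<in>records P m. P0 h * ln (P0 h / Px x h) +
        P0 h * (\<Sum>k\<in>outcomes P h. b0 h k * ln (b0 h k / b x h k)))"
    by (rule sum.cong[OF refl], subst sum_records_Suc[OF R(1) fin], assumption,
        rule sum.cong[OF refl], rule inner)
  also have "\<dots> = (\<Sum>x\<in>S. \<Sum>os\<in>records P m. P0 os * ln (P0 os / Px x os)) +
      (\<Sum>x\<in>S. \<Sum>h\<in>records P m. P0 h * (\<Sum>k\<in>outcomes P h. b0 h k * ln (b0 h k / b x h k)))"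
    by (simp only: sum.distrib)
  \<comment> \<open>The weight \<open>P0 h\<close> does not depend on \<open>x\<close>, so the sums
    can be exchanged.\<close>
  also have "(\<Sum>x\<in>S. \<Sum>h\<in>records P m. P0 h * (\<Sum>k\<in>outcomes P h. b0 h k * ln (b0 h k / b x h k))) =
      (\<Sum>h\<in>records P m. P0 h * (\<Sum>x\<in>S. \<Sum>k\<in>outcomes P h. b0 h k * ln (b0 h k / b x h k)))"
    by (subst sum.swap) (simp only: sum_distrib_left)
  also have "\<dots> \<le> (\<Sum>h\<in>records P m. P0 h * B)"
    unfolding P0_def using m
    by (intro sum_mono mult_left_mono round
        record_prob_dstate_pos(1)[OF d P(1) z t, of m]) auto
  also have "\<dots> = B" using R(2) by (simp flip: sum_distrib_right)
  finally show ?case using Suc.IH m by (simp add: distrib_right)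
qed

text \<open>Of the disjoint success events for \<open>y\<close> and \<open>- y\<close> one has probability at most \<open>1 / 2\<close> under the
  maximally mixed state. Comparing the two signs, rather than one sign with the maximally mixed state,
  halves the \<open>t\<close> needed and so keeps the likelihood ratios bounded away from \<open>0\<close> up to \<open>\<epsilon> = 1 / 6\<close>.\<close>

lemma divergence_lower_bound:
  assumes d: "d > 0" and P: "copywise_protocol d N P" and L: "learns_amplitudes d N \<epsilon> P"
    and qp: "q < d" "p < d" "(q, p) \<noteq> (0, 0)"
    and t: "0 \<le> t" "2 * t + t\<^sup>2 \<le> 7 / 8" and \<epsilon>: "2 * \<epsilon> < t"
  obtains z where "cmod z = 1"
    "1 / 18 \<le> (\<Sum>os\<in>records P N. record_prob P (dstate d 0 1 0 0) os *
      ln (record_prob P (dstate d 0 1 0 0) os / record_prob P (dstate d t z q p) os))"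
proof -
  obtain y where y: "cmod y = 1"
    and sep: "t \<le> cmod (amplitude d (dstate d t y q p) q p - amplitude d (dstate d t (- y) q p) q p)"
    using exists_separated_phase[OF d t(1)] .
  define R where "R = records P N"
  define P0 where "P0 = record_prob P (dstate d 0 1 0 0)"
  define E where "E z = {os \<in> R. \<forall>q'<d. \<forall>p'<d. cmod (estimate P os q' p' - amplitude d (dstate d t z q p) q' p') \<le> \<epsilon>}" for z
  have "t \<le> 1" using t zero_le_power2[of t] by linarith
  have dens0: "density_op d (dstate d 0 1 0 0)" by (rule density_dstate) (use d in auto)
  have dens: "density_op d (dstate d t z q p)" if "cmod z = 1" for z
    using that t \<open>t \<le> 1\<close> d qp by (intro density_dstate) auto
  have fin: "finite R" and tot0: "sum P0 R = 1"
    using records_total_prob[OF P dens0, of N] by (auto simp: R_def P0_def)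
  have nn: "0 \<le> P0 os" if "os \<in> R" for os
    using record_prob_dstate_pos(1)[OF d P y t order_refl] that by (simp add: R_def P0_def)
  have disj: "E y \<inter> E (- y) = {}"
  proof (rule equals0I)
    fix os assume "os \<in> E y \<inter> E (- y)"
    then have 1: "cmod (estimate P os q p - amplitude d (dstate d t y q p) q p) \<le> \<epsilon>"
      and 2: "cmod (estimate P os q p - amplitude d (dstate d t (- y) q p) q p) \<le> \<epsilon>"
      using qp by (auto simp: E_def)
    have "cmod (amplitude d (dstate d t y q p) q p - amplitude d (dstate d t (- y) q p) q p) \<le> \<epsilon> + \<epsilon>"
      using norm_triangle_le_diff[of "estimate P os q p - amplitude d (dstate d t (- y) q p) q p"
          "estimate P os q p - amplitude d (dstate d t y q p) q p" "\<epsilon> + \<epsilon>"] 1 2 by simp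
    then show False using sep \<epsilon> by simp
  qed
  have "sum P0 (E y) + sum P0 (E (- y)) = sum P0 (E y \<union> E (- y))"
    using fin disj by (intro sum.union_disjoint[symmetric]) (auto simp: E_def)
  also have "\<dots> \<le> sum P0 R"
    using fin nn by (intro sum_mono2) (auto simp: E_def)
  finally have "sum P0 (E y) \<le> 1 / 2 \<or> sum P0 (E (- y)) \<le> 1 / 2" using tot0 by linarith
  then obtain z where z: "cmod z = 1" "sum P0 (E z) \<le> 1 / 2"
    using y by (metis norm_minus_cancel)
  have "2 / 3 \<le> sum (record_prob P (dstate d t z q p)) (E z)"
    using L dens[OF z(1)] unfolding learns_amplitudes_def success_prob_def E_def R_def by blast
  then have "1 / 18 \<le> (\<Sum>os\<in>R. P0 os * ln (P0 os / record_prob P (dstate d t z q p) os))"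
    using fin nn tot0 z(2) records_total_prob[OF P dens[OF z(1)] order_refl]
      record_prob_dstate_pos[OF d P z(1) t order_refl]
    by (intro divergence_event_lower_bound[where E = "E z"]) (auto simp: R_def P0_def E_def)
  then show ?thesis using that z(1) by (simp add: R_def P0_def)
qed

section \<open>The lower bound on the number of copies\<close>

theorem corollary2:
  shows "\<exists>c::real. c > 0 \<and>
    (\<forall>(d::nat) (\<epsilon>::real) (\<eta>::real) (N::nat) (P::protocol).
       d \<ge> 2 \<longrightarrow> 0 < \<epsilon> \<longrightarrow> \<epsilon> < 1 / 6 \<longrightarrow> \<eta> \<ge> 0 \<longrightarrow>
       copywise_protocol d N P \<longrightarrow>
       protocol_bounded d N \<eta> P \<longrightarrow>
       learns_amplitudes d N \<epsilon> P \<longrightarrow>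
       real N \<ge> c * (1 / \<epsilon>\<^sup>2) * sqrt (real d * 2 powr (- \<eta>)))"
proof (intro exI[of _ "1 / 13824"] conjI allI impI)
  fix d N :: nat and \<epsilon> \<eta> :: real and P :: protocol
  assume d2: "d \<ge> 2" and \<epsilon>: "0 < \<epsilon>" "\<epsilon> < 1 / 6" and \<eta>: "\<eta> \<ge> 0"
    and P: "copywise_protocol d N P" "protocol_bounded d N \<eta> P" and L: "learns_amplitudes d N \<epsilon> P"
  have d: "d > 0" using d2 by simp
  \<comment> \<open>The factor exceeds \<open>2\<close>, so that the success events of opposite
    signs are disjoint, and is small enough that \<open>2 * t + t^2\<close> is at most
    \<open>781 / 900 < 7 / 8\<close> when \<epsilon> is below \<open>1 / 6\<close>.\<close>
  define t where "t = 11 / 5 * \<epsilon>"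
  define K where "K = 2 powr \<eta>"
  have K: "K \<ge> 1" using \<eta> by (simp add: K_def ge_one_powr_ge_zero)
  have t2: "t\<^sup>2 = 121 / 25 * \<epsilon>\<^sup>2" by (simp add: t_def power2_eq_square)
  have t4: "t ^ 4 = 14641 / 625 * \<epsilon> ^ 4" by (simp add: t_def power_mult_distrib power_divide)
  have "\<epsilon>\<^sup>2 \<le> (1 / 6)\<^sup>2" using \<epsilon> by (intro power_mono) auto
  then have t: "0 \<le> t" "2 * t + t\<^sup>2 \<le> 7 / 8" "2 * \<epsilon> < t"
    using \<epsilon> unfolding t2 by (simp_all add: t_def power2_eq_square)
  define S where "S = square d - {(0, 0)}"
  \<comment> \<open>Outside \<open>S\<close> the arbitrary phase \<open>1\<close> is taken, so that
    \<open>z\<close> becomes a total function of modulus one.\<close>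
  have "\<exists>z. cmod z = 1 \<and> (x \<in> S \<longrightarrow> 1 / 18 \<le> (\<Sum>os\<in>records P N. record_prob P (dstate d 0 1 0 0) os *
      ln (record_prob P (dstate d 0 1 0 0) os / record_prob P (dstate d t z (fst x) (snd x)) os)))" for x
  proof (cases "x \<in> S")
    case True
    then show ?thesis
      using divergence_lower_bound[OF d P(1) L, of "fst x" "snd x" t] t by (auto simp: S_def) blast
  qed (auto intro: exI[of _ 1])
  then obtain z where z: "\<And>x. cmod (z x) = 1"
    and div: "\<And>x. x \<in> S \<Longrightarrow> 1 / 18 \<le> (\<Sum>os\<in>records P N. record_prob P (dstate d 0 1 0 0) os *
      ln (record_prob P (dstate d 0 1 0 0) os / record_prob P (dstate d t (z x) (fst x) (snd x)) os))"
    by metis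
  have "real (card S) * (1 / 18) \<le> (\<Sum>x\<in>S. \<Sum>os\<in>records P N. record_prob P (dstate d 0 1 0 0) os *
      ln (record_prob P (dstate d 0 1 0 0) os / record_prob P (dstate d t (z x) (fst x) (snd x)) os))"
    by (rule sum_bounded_below[OF div])
  also have "\<dots> \<le> real N * (12 * real d * (2 * t\<^sup>2 + t ^ 4 * K))"
    using total_divergence_le[OF d P, of "\<lambda>q p. z (q, p)" t N] z t unfolding S_def K_def by simp
  finally have main: "real (card S) \<le> 18 * real N * (12 * real d * (2 * t\<^sup>2 + t ^ 4 * K))" by simp
  have "card S = d * d - 1" using d by (simp add: S_def card_cartesian_product)
  then have "real (card S) = real d * real d - 1" using d by (simp add: of_nat_diff)
  moreover have "2 * 2 \<le> real d * real d" using d2 by (intro mult_mono) auto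
  ultimately have cS: "real (card S) \<ge> 3 / 4 * (real d * real d)" by argo
  \<comment> \<open>The coefficients \<open>242 / 25\<close> and \<open>14641 / 625\<close> are both
    rounded up to \<open>24\<close>.\<close>
  have "2 * t\<^sup>2 + t ^ 4 * K \<le> 24 * (\<epsilon>\<^sup>2 + \<epsilon> ^ 4 * K)"
  proof -
    have "2 * (121 / 25 * \<epsilon>\<^sup>2) + 14641 / 625 * (\<epsilon> ^ 4 * K) \<le> 24 * \<epsilon>\<^sup>2 + 24 * (\<epsilon> ^ 4 * K)"
      using K \<epsilon> by (intro add_mono mult_right_mono) simp_all
    then show ?thesis unfolding t2 t4 by (simp only: distrib_left mult.assoc)
  qed
  then have "18 * real N * (12 * real d * (2 * t\<^sup>2 + t ^ 4 * K)) \<le>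
      18 * real N * (12 * real d * (24 * (\<epsilon>\<^sup>2 + \<epsilon> ^ 4 * K)))"
    by (intro mult_left_mono) auto
  with main cS have "3 / 4 * (real d * real d) \<le> 18 * real N * (12 * real d * (24 * (\<epsilon>\<^sup>2 + \<epsilon> ^ 4 * K)))"
    by linarith
  then have "real d * (3 * real d) \<le> real d * (20736 * (real N * (\<epsilon>\<^sup>2 + \<epsilon> ^ 4 * K)))"
    by (simp add: algebra_simps)
  \<comment> \<open>Here \<open>6912 = 4 / 3 * 18 * 12 * 24\<close>; each case below doubles the
    larger of the two summands, which gives \<open>13824\<close>.\<close>
  then have key: "real d \<le> 6912 * (real N * (\<epsilon>\<^sup>2 + \<epsilon> ^ 4 * K))" using d by simp
  then have "N \<noteq> 0" using d by (intro notI) simp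
  then have N1: "real N \<ge> 1" by simp
  define y where "y = sqrt (real d / K) / \<epsilon>\<^sup>2"
  have y: "y \<ge> 0" "y\<^sup>2 = real d / (K * \<epsilon> ^ 4)"
    using K by (simp_all add: y_def power_divide flip: power_mult)
  \<comment> \<open>If \<open>\<epsilon>^2\<close> dominates, \<open>key\<close> bounds
    \<open>d / \<epsilon>^2\<close>, which is at least \<open>y\<close>. If
    \<open>\<epsilon>^4 * K\<close> dominates, it bounds \<open>y^2\<close>; this suffices for
    \<open>y > 1\<close>, and otherwise \<open>N \<ge> 1\<close> does.\<close>
  have "y \<le> 13824 * real N"
  proof (cases "\<epsilon>\<^sup>2 * K \<le> 1")
    case True
    have "\<epsilon>\<^sup>2 * (\<epsilon>\<^sup>2 * K) \<le> \<epsilon>\<^sup>2 * 1" using True by (intro mult_left_mono) auto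
    then have "\<epsilon> ^ 4 * K \<le> \<epsilon>\<^sup>2" by (simp add: power4_eq_xxxx power2_eq_square mult.assoc)
    then have "real N * (\<epsilon>\<^sup>2 + \<epsilon> ^ 4 * K) \<le> real N * (2 * \<epsilon>\<^sup>2)" by (intro mult_left_mono) auto
    with key have "real d \<le> 13824 * real N * \<epsilon>\<^sup>2" by simp
    moreover have "sqrt (real d / K) \<le> real d"
    proof (rule real_le_lsqrt)
      have "real d / K \<le> real d" using K by (simp add: divide_le_eq mult_le_cancel_left1)
      also have "\<dots> \<le> (real d)\<^sup>2" using d by (simp add: power2_eq_square)
      finally show "real d / K \<le> (real d)\<^sup>2" .
    qed auto
    ultimately show ?thesis unfolding y_def using \<epsilon> by (simp add: divide_le_eq)
  next
    case False
    have "\<epsilon>\<^sup>2 * 1 \<le> \<epsilon>\<^sup>2 * (\<epsilon>\<^sup>2 * K)" using False by (intro mult_left_mono) auto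
    then have "\<epsilon>\<^sup>2 \<le> \<epsilon> ^ 4 * K" by (simp add: power4_eq_xxxx power2_eq_square mult.assoc)
    then have "real N * (\<epsilon>\<^sup>2 + \<epsilon> ^ 4 * K) \<le> real N * (2 * (\<epsilon> ^ 4 * K))"
      by (intro mult_left_mono) linarith+
    with key have "real d \<le> 6912 * (real N * (2 * (\<epsilon> ^ 4 * K)))" by linarith
    then have "real d \<le> 13824 * real N * (K * \<epsilon> ^ 4)" by (simp add: mult_ac)
    then have ysq: "y\<^sup>2 \<le> 13824 * real N" unfolding y(2) using K \<epsilon> by (simp add: divide_le_eq)
    show ?thesis
    proof (cases "y \<le> 1")
      case True
      then show ?thesis using N1 by simp
    next
      case False
      then have "y * 1 \<le> y * y" using y(1) by (intro mult_left_mono) auto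
      then show ?thesis using ysq by (simp add: power2_eq_square)
    qed
  qed
  moreover have "real d * 2 powr (- \<eta>) = real d / K" by (simp add: K_def powr_minus divide_inverse)
  ultimately show "1 / 13824 * (1 / \<epsilon>\<^sup>2) * sqrt (real d * 2 powr (- \<eta>)) \<le> real N"
    unfolding y_def by (simp add: field_simps)
qed simp

end
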